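(* Let $C: f=0$ be a reduced plane curve of degree $d\geq 3$ in $\mathbb{P}^2$ of type $(d,r,m)$ with $m>3$, and suppose $\Delta m:=(2r-d+3)-m=3$. Then, with $\epsilon_1,\ldots,\epsilon_{m-2}$ as in the context, one of the following holds: (1) $\epsilon_{m-2}=4$, $\epsilon_j=1$ for $1\leq j\leq m-3$, and $\tau(C)=\frac{d(d-1)}{2}-6+r(d-r-2)$; (2) $\epsilon_{m-2}=3$, $\epsilon_{m-3}=2$, $\epsilon_j=1$ for $1\leq j\leq m-4$, and $\tau(C)=\frac{d(d-1)}{2}-4+r(d-r-2)$; (3) $\epsilon_{m-2}=\epsilon_{m-3}=\epsilon_{m-4}=2$, $\epsilon_j=1$ for $1\leq j\leq m-5$, and $\tau(C)=\frac{d(d-1)}{2}-3+r(d-r-2)$.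
   Context: Let $S=\mathbb{C}[x,y,z]$, let $f\in S$ be a reduced homogeneous polynomial of degree $d\geq 3$ defining $C$, and assume $C$ is not a union of $d$ lines through one point. Let $J_f=(f_x,f_y,f_z)$ and $M(f)=S/J_f$. Let $D_0(f)=\{(a,b,c)\in S^3: af_x+bf_y+cf_z=0\}$. The curve is of type $(d,r,m)$ if $D_0(f)$ is minimally generated by $m$ homogeneous elements all of degree $r$. When $m\geq 3$, the minimal graded free resolution of $M(f)$ has the form $$0\to \bigoplus_{i=1}^{m-2}S(-e_i)\to \bigoplus_{j=1}^m S(1-d-r)\to S^3(1-d)\to S,$$ with $e_1\leq\cdots\leq e_{m-2}$, and one writes $e_j=d+r-1+\epsilon_j$ with integers $\epsilon_j\geq 1$. The total Tjurina number $\tau(C)$ is the degree of $J_f$, i.e. the sum of the Tjurina numbers of the singular points of $C$. *)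

theory Defs
  imports Complex_Main "HOL-Library.Poly_Mapping" "HOL-Library.Product_Plus"
begin

text \<open>The polynomial ring S = C[x,y,z]. A monomial x^a y^b z^c is the exponent
  triple (a,b,c); a polynomial is a finitely supported map from exponent triples
  to complex coefficients (Poly_Mapping supplies the ring structure).\<close>

type_synonym mono3 = "nat \<times> nat \<times> nat"
type_synonym cpoly = "mono3 \<Rightarrow>\<^sub>0 complex"
type_synonym vec3 = "cpoly \<times> cpoly \<times> cpoly"

definition mdeg :: "mono3 \<Rightarrow> nat" where
  "mdeg m = fst m + fst (snd m) + snd (snd m)"

text \<open>p is homogeneous of degree k (the zero polynomial is homogeneous of every degree).\<close>
definition homogeneous :: "nat \<Rightarrow> cpoly \<Rightarrow> bool" where
  "homogeneous k p \<longleftrightarrow> (\<forall>m\<in>Poly_Mapping.keys p. mdeg m = k)"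

definition const :: "complex \<Rightarrow> cpoly" where
  "const c = Poly_Mapping.single 0 c"

definition smul :: "complex \<Rightarrow> cpoly \<Rightarrow> cpoly" where
  "smul c p = const c * p"

definition dx :: "cpoly \<Rightarrow> cpoly" where
  "dx p = (\<Sum>m\<in>Poly_Mapping.keys p. case m of (a,b,c) \<Rightarrow>
            Poly_Mapping.single (a - 1, b, c) (of_nat a * Poly_Mapping.lookup p m))"
definition dy :: "cpoly \<Rightarrow> cpoly" where
  "dy p = (\<Sum>m\<in>Poly_Mapping.keys p. case m of (a,b,c) \<Rightarrow>
            Poly_Mapping.single (a, b - 1, c) (of_nat b * Poly_Mapping.lookup p m))"
definition dz :: "cpoly \<Rightarrow> cpoly" where
  "dz p = (\<Sum>m\<in>Poly_Mapping.keys p. case m of (a,b,c) \<Rightarrow>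
            Poly_Mapping.single (a, b, c - 1) (of_nat c * Poly_Mapping.lookup p m))"

definition peval :: "cpoly \<Rightarrow> complex \<times> complex \<times> complex \<Rightarrow> complex" where
  "peval p v = (\<Sum>m\<in>Poly_Mapping.keys p. case m of (a,b,c) \<Rightarrow> case v of (u,w,t) \<Rightarrow>
                 Poly_Mapping.lookup p m * u ^ a * w ^ b * t ^ c)"

definition reduced :: "cpoly \<Rightarrow> bool" where
  "reduced f \<longleftrightarrow> f \<noteq> 0 \<and> (\<forall>g. g * g dvd f \<longrightarrow> (\<exists>c. g = const c))"

definition concurrent_lines :: "nat \<Rightarrow> cpoly \<Rightarrow> bool" where
  "concurrent_lines d f \<longleftrightarrow>
     (\<exists>v L. v \<noteq> (0,0,0) \<and> (\<forall>i<d. homogeneous 1 (L i) \<and> L i \<noteq> 0 \<and> peval (L i) v = 0)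
            \<and> f = (\<Prod>i<d. L i))"

definition D0 :: "cpoly \<Rightarrow> vec3 set" where
  "D0 f = {(a,b,c). a * dx f + b * dy f + c * dz f = 0}"

definition vhomogeneous :: "nat \<Rightarrow> vec3 \<Rightarrow> bool" where
  "vhomogeneous k v \<longleftrightarrow> homogeneous k (fst v) \<and> homogeneous k (fst (snd v)) \<and> homogeneous k (snd (snd v))"

definition vscale :: "cpoly \<Rightarrow> vec3 \<Rightarrow> vec3" where
  "vscale h v = (h * fst v, h * fst (snd v), h * snd (snd v))"

definition vsum :: "(nat \<Rightarrow> vec3) \<Rightarrow> nat \<Rightarrow> vec3" where
  "vsum g n = ((\<Sum>j<n. fst (g j)), (\<Sum>j<n. fst (snd (g j))), (\<Sum>j<n. snd (snd (g j))))"

definition generates :: "vec3 set \<Rightarrow> nat \<Rightarrow> (nat \<Rightarrow> vec3) \<Rightarrow> bool" where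
  "generates M n \<rho> \<longleftrightarrow> (\<forall>j<n. \<rho> j \<in> M) \<and>
      (\<forall>v\<in>M. \<exists>h. v = vsum (\<lambda>j. vscale (h j) (\<rho> j)) n)"

definition min_gen_D0 :: "cpoly \<Rightarrow> nat \<Rightarrow> nat \<Rightarrow> (nat \<Rightarrow> vec3) \<Rightarrow> bool" where
  "min_gen_D0 f r m \<rho> \<longleftrightarrow> generates (D0 f) m \<rho> \<and> (\<forall>j<m. vhomogeneous r (\<rho> j)) \<and>
     (\<forall>n \<sigma> k. n < m \<longrightarrow> (\<forall>j<n. vhomogeneous (k j) (\<sigma> j)) \<longrightarrow> \<not> generates (D0 f) n \<sigma>)"

definition curve_type :: "cpoly \<Rightarrow> nat \<Rightarrow> nat \<Rightarrow> nat \<Rightarrow> bool" where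
  "curve_type f d r m \<longleftrightarrow> (\<exists>\<rho>. min_gen_D0 f r m \<rho>)"

text \<open>Relations among rho_0..rho_(m-1): vectors (h_0..h_(m-1)) in S^m (encoded as
  functions nat => cpoly, entries j < m relevant) with sum h_j rho_j = 0.\<close>
definition relations :: "nat \<Rightarrow> (nat \<Rightarrow> vec3) \<Rightarrow> (nat \<Rightarrow> cpoly) set" where
  "relations m \<rho> = {h. vsum (\<lambda>j. vscale (h j) (\<rho> j)) m = (0,0,0)}"

text \<open>The homogeneous family sigma_0..sigma_(n-1) of relations, sigma_i of degree eps i,
  generates the relation module (the second syzygies; the last term of the resolution
  is then the sum of S(-e_i) with e_i = d + r - 1 + eps i).\<close>
definition gen_relations ::
   "nat \<Rightarrow> (nat \<Rightarrow> vec3) \<Rightarrow> nat \<Rightarrow> (nat \<Rightarrow> nat \<Rightarrow> cpoly) \<Rightarrow> (nat \<Rightarrow> nat) \<Rightarrow> bool" where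
  "gen_relations m \<rho> n \<sigma> eps \<longleftrightarrow>
     (\<forall>i<n. \<sigma> i \<in> relations m \<rho> \<and> (\<forall>j<m. homogeneous (eps i) (\<sigma> i j))) \<and>
     (\<forall>h\<in>relations m \<rho>. \<exists>g. \<forall>j<m. h j = (\<Sum>i<n. g i * \<sigma> i j))"

definition jacobian_ideal :: "cpoly \<Rightarrow> cpoly set" where
  "jacobian_ideal f = {a * dx f + b * dy f + c * dz f | a b c. True}"

definition lin_indep_mod :: "cpoly set \<Rightarrow> cpoly set \<Rightarrow> bool" where
  "lin_indep_mod W B \<longleftrightarrow> finite B \<and>
     (\<forall>c. (\<Sum>p\<in>B. smul (c p) p) \<in> W \<longrightarrow> (\<forall>p\<in>B. c p = 0))"

definition quot_dim :: "cpoly set \<Rightarrow> nat \<Rightarrow> nat" where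
  "quot_dim I k = Max {card B | B. B \<subseteq> {p. homogeneous k p} \<and> lin_indep_mod I B}"

text \<open>Total Tjurina number: the degree of J_f, i.e. the eventual (constant) value of
  the Hilbert function of M(f) = S/J_f.\<close>
definition tjurina :: "cpoly \<Rightarrow> nat" where
  "tjurina f = (THE t. \<forall>\<^sub>F k in sequentially. quot_dim (jacobian_ideal f) k = t)"

end

theory Submission
  imports Defs "HOL-Library.Function_Algebras" "HOL-Computational_Algebra.Polynomial_Factorial"
    "HOL-Computational_Algebra.Field_as_Ring"
begin

text \<open>
  The resolution is counted degree by degree. In degree \<open>k = d - 1 + r + q\<close> it expresses
  the dimension of \<open>M(f)\<^sub>k\<close> through the dimensions of spaces of forms, up to the dimension
  \<open>\<kappa>(q)\<close> of the space of relations among the second syzygies \<open>\<sigma>\<close>; since there are \<open>m - 2\<close> of these,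
  the terms quadratic in \<open>q\<close> cancel and \<open>2 dim M(f)\<^sub>k = - L q + c + 2 \<kappa>(q)\<close>.

  As \<open>f\<close> is reduced, Euler's formula shows that its partial derivatives have no common prime factor.
  Writing \<open>f\<^sub>x = h a\<close>, \<open>f\<^sub>y = h b\<close> with \<open>a\<close>, \<open>b\<close> coprime, the third entry of a
  syzygy of the gradient is then a multiple of \<open>h\<close>, and the syzygies with third entry zero are the
  multiples of \<open>(b, -a, 0)\<close>; this bounds the syzygies from above and makes \<open>dim M(f)\<^sub>k\<close> bounded.
  A nonzero relation among the \<open>\<sigma>\<^sub>i\<close> would make \<open>\<kappa>\<close> grow quadratically, so \<open>\<kappa> = 0\<close>; then \<open>L = 0\<close>,
  which says that the \<open>\<epsilon>\<^sub>i\<close> sum to \<open>2 r - d + 1\<close>, and \<open>c\<close> is twice the Tjurina number.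
  Minimality of the generators gives \<open>\<epsilon>\<^sub>i \<ge> 1\<close>, so the numbers \<open>\<epsilon>\<^sub>i - 1\<close> form a partition of 3.
\<close>

subsection \<open>Homogeneous polynomials and their derivatives\<close>

lemma cpoly_sum_singles:
  "(p :: cpoly) = (\<Sum>m\<in>Poly_Mapping.keys p. Poly_Mapping.single m (Poly_Mapping.lookup p m))"
proof (rule poly_mapping_eqI)
  fix k
  show "Poly_Mapping.lookup p k = Poly_Mapping.lookup
     (\<Sum>m\<in>Poly_Mapping.keys p. Poly_Mapping.single m (Poly_Mapping.lookup p m)) k"
    by (simp add: lookup_sum lookup_single when_def in_keys_iff)
qed

text \<open>Reduces identities that are additive in a polynomial to single terms; zero needs no case
  of its own, being a term with coefficient 0.\<close>

lemma cpoly_induct [case_names single add]: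
  assumes "\<And>m v. P (Poly_Mapping.single m v)" and "\<And>p q. P p \<Longrightarrow> P q \<Longrightarrow> P (p + q)"
  shows "P (p :: cpoly)"
proof -
  have z: "P 0" using assms(1)[of 0 0] by simp
  have "P (\<Sum>m\<in>A. Poly_Mapping.single m (Poly_Mapping.lookup p m))" if "finite A" for A
    using that by (induction A) (use z assms in auto)
  then show ?thesis using cpoly_sum_singles[of p] by (metis finite_keys)
qed

section \<open>Additivity and the Leibniz rule for the partial derivatives\<close>

lemma dx_add: "dx (p + q) = dx p + dx q"
  unfolding dx_def by (rule setsum_keys_plus_distrib) (auto simp: algebra_simps single_add)
lemma dy_add: "dy (p + q) = dy p + dy q"
  unfolding dy_def by (rule setsum_keys_plus_distrib) (auto simp: algebra_simps single_add)
lemma dz_add: "dz (p + q) = dz p + dz q"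
  unfolding dz_def by (rule setsum_keys_plus_distrib) (auto simp: algebra_simps single_add)

lemma dx_single: "dx (Poly_Mapping.single (a,b,c) v) = Poly_Mapping.single (a-1,b,c) (of_nat a * v)"
  by (cases "v = 0") (simp_all add: dx_def)
lemma dy_single: "dy (Poly_Mapping.single (a,b,c) v) = Poly_Mapping.single (a,b-1,c) (of_nat b * v)"
  by (cases "v = 0") (simp_all add: dy_def)
lemma dz_single: "dz (Poly_Mapping.single (a,b,c) v) = Poly_Mapping.single (a,b,c-1) (of_nat c * v)"
  by (cases "v = 0") (simp_all add: dz_def)

lemma dx_mult: "dx (p * q) = dx p * q + p * dx q"
proof (induction p rule: cpoly_induct)
  case (single m v)
  show ?case
  proof (induction q rule: cpoly_induct)
    case (single n w)
    obtain a b c where m: "m = (a,b,c)" by (cases m)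
    obtain a' b' c' where n: "n = (a',b',c')" by (cases n)
    \<comment> \<open>At exponent 0 the subtraction in \<open>a - 1\<close> truncates, but the
      coefficient \<open>of_nat a\<close> vanishes there; hence the case split on both
      exponents.\<close>
    show ?case unfolding m n
      by (cases a; cases a') (simp_all add: mult_single dx_single algebra_simps flip: single_add)
  qed (simp add: algebra_simps dx_add)
qed (simp add: algebra_simps dx_add)
lemma dy_mult: "dy (p * q) = dy p * q + p * dy q"
proof (induction p rule: cpoly_induct)
  case (single m v)
  show ?case
  proof (induction q rule: cpoly_induct)
    case (single n w)
    obtain a b c where m: "m = (a,b,c)" by (cases m)
    obtain a' b' c' where n: "n = (a',b',c')" by (cases n)
    show ?case unfolding m n
      by (cases b; cases b') (simp_all add: mult_single dy_single algebra_simps flip: single_add)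
  qed (simp add: algebra_simps dy_add)
qed (simp add: algebra_simps dy_add)
lemma dz_mult: "dz (p * q) = dz p * q + p * dz q"
proof (induction p rule: cpoly_induct)
  case (single m v)
  show ?case
  proof (induction q rule: cpoly_induct)
    case (single n w)
    obtain a b c where m: "m = (a,b,c)" by (cases m)
    obtain a' b' c' where n: "n = (a',b',c')" by (cases n)
    show ?case unfolding m n
      by (cases c; cases c') (simp_all add: mult_single dz_single algebra_simps flip: single_add)
  qed (simp add: algebra_simps dz_add)
qed (simp add: algebra_simps dz_add)

section \<open>Degrees and homogeneous components\<close>

lemma mdeg_add [simp]: "mdeg (m + n) = mdeg m + mdeg n"
  by (simp add: mdeg_def)

lemma mdeg_eq_0_iff: "mdeg m = 0 \<longleftrightarrow> m = 0"
  by (cases m) (auto simp: mdeg_def zero_prod_def)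

lemma lookup_const: "Poly_Mapping.lookup (const c) m = (if m = 0 then c else 0)"
  by (simp add: const_def lookup_single when_def)
lemma const_0 [simp]: "const 0 = 0" by (simp add: const_def)
lemma const_1 [simp]: "const 1 = 1" by (simp add: const_def)
lemma const_add: "const (a + b) = const a + const b" by (simp add: const_def single_add)
lemma const_mult: "const (a * b) = const a * const b" by (simp add: const_def mult_single)
lemma const_eq_0_iff [simp]: "const a = 0 \<longleftrightarrow> a = 0" by (metis const_def const_0 lookup_single_eq lookup_zero)

lemma const_single: "const c * Poly_Mapping.single m v = Poly_Mapping.single m (c * v)"
  by (simp add: const_def mult_single)

lemma lookup_const_mult [simp]: "Poly_Mapping.lookup (const c * p) m = c * Poly_Mapping.lookup p m"
  by (induction p rule: cpoly_induct) (simp_all add: const_single lookup_single when_def lookup_add algebra_simps)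

definition hom_part :: "nat \<Rightarrow> cpoly \<Rightarrow> cpoly" where
  "hom_part k p = (\<Sum>m\<in>Poly_Mapping.keys p. if mdeg m = k then Poly_Mapping.single m (Poly_Mapping.lookup p m) else 0)"

lemma lookup_hom_part [simp]: "Poly_Mapping.lookup (hom_part k p) m = (if mdeg m = k then Poly_Mapping.lookup p m else 0)"
proof -
  have "Poly_Mapping.lookup (hom_part k p) m = (\<Sum>n\<in>Poly_Mapping.keys p. if n = m then (if mdeg m = k then Poly_Mapping.lookup p m else 0) else 0)"
    unfolding hom_part_def lookup_sum by (rule sum.cong) (auto simp: lookup_single when_def)
  then show ?thesis by (simp add: in_keys_iff)
qed

lemma homogeneous_iff_lookup: "homogeneous k p \<longleftrightarrow> (\<forall>m. Poly_Mapping.lookup p m \<noteq> 0 \<longrightarrow> mdeg m = k)"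
  by (auto simp: homogeneous_def in_keys_iff)

lemma homogeneous_hom_part [simp]: "homogeneous k (hom_part k p)"
  by (simp add: homogeneous_iff_lookup)

lemma homogeneous_iff_hom_part: "homogeneous k p \<longleftrightarrow> hom_part k p = p"
  by (auto simp: homogeneous_iff_lookup poly_mapping_eq_iff fun_eq_iff)

lemma hom_part_homogeneous: "homogeneous k p \<Longrightarrow> hom_part i p = (if i = k then p else 0)"
  by (rule poly_mapping_eqI) (auto simp: homogeneous_iff_lookup)

lemma hom_part_0 [simp]: "hom_part k 0 = 0" and hom_part_add: "hom_part k (p + q) = hom_part k p + hom_part k q"
  and hom_part_uminus: "hom_part k (- p) = - hom_part k p"
  by (rule poly_mapping_eqI; simp add: lookup_add)+

lemma hom_part_sum: "hom_part k (\<Sum>i\<in>A. g i) = (\<Sum>i\<in>A. hom_part k (g i))"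
  by (induction A rule: infinite_finite_induct) (auto simp: hom_part_add)

lemma homogeneous_0 [simp]: "homogeneous k 0"
  by (simp add: homogeneous_def)

lemma homogeneous_add: "homogeneous k p \<Longrightarrow> homogeneous k q \<Longrightarrow> homogeneous k (p + q)"
  by (simp add: homogeneous_iff_hom_part hom_part_add)

lemma homogeneous_sum: "(\<And>i. i \<in> A \<Longrightarrow> homogeneous k (g i)) \<Longrightarrow> homogeneous k (\<Sum>i\<in>A. g i)"
  by (simp add: homogeneous_iff_hom_part hom_part_sum)

lemma homogeneous_const [simp]: "homogeneous 0 (const c)"
  by (auto simp: homogeneous_iff_lookup lookup_const mdeg_eq_0_iff)

lemma homogeneous_0D: "homogeneous 0 p \<Longrightarrow> \<exists>c. p = const c"
  by (rule exI[of _ "Poly_Mapping.lookup p 0"], rule poly_mapping_eqI)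
     (auto simp: homogeneous_iff_lookup lookup_const mdeg_eq_0_iff)

lemma hom_part_single: "hom_part k (Poly_Mapping.single m v) = (if mdeg m = k then Poly_Mapping.single m v else 0)"
  by (rule poly_mapping_eqI) (auto simp: lookup_single when_def)

lemma hom_part_mult: "hom_part k (p * q) = (\<Sum>i\<le>k. hom_part i p * hom_part (k - i) q)"
proof (induction p rule: cpoly_induct)
  case (single m v)
  show ?case
  proof (induction q rule: cpoly_induct)
    case (single n w)
    have "(\<Sum>i\<le>k. hom_part i (Poly_Mapping.single m v) * hom_part (k - i) (Poly_Mapping.single n w))
      = (\<Sum>i\<le>k. if i = mdeg m then (if mdeg n = k - mdeg m then Poly_Mapping.single (m+n) (v*w) else 0) else 0)"
      by (rule sum.cong) (auto simp: hom_part_single mult_single)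
    then show ?case by (auto simp: mult_single hom_part_single)
  qed (simp add: algebra_simps hom_part_add sum.distrib)
qed (simp add: algebra_simps hom_part_add sum.distrib)

text \<open>Only the index \<open>k - e\<close> of the convolution survives. Through this rule
  arbitrary coefficients of a representation are later cut down to forms.\<close>

lemma hom_part_mult_homogeneous:
  assumes "homogeneous e q"
  shows "hom_part k (p * q) = (if e \<le> k then hom_part (k - e) p * q else 0)"
proof -
  have "hom_part k (p * q) = (\<Sum>i\<le>k. if i = k - e then (if e \<le> k then hom_part (k - e) p * q else 0) else 0)"
    unfolding hom_part_mult by (rule sum.cong) (use assms in \<open>auto simp: hom_part_homogeneous\<close>)
  then show ?thesis by simp
qed

lemma homogeneous_mult: "homogeneous i p \<Longrightarrow> homogeneous j q \<Longrightarrow> homogeneous (i + j) (p * q)"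
  unfolding homogeneous_iff_hom_part[of "i+j"] by (simp add: hom_part_mult_homogeneous) (simp add: homogeneous_iff_hom_part)

lemma homogeneous_smul [simp]: "homogeneous k p \<Longrightarrow> homogeneous k (const c * p)"
  using homogeneous_mult[of 0 "const c" k p] by simp

lemma homogeneous_single: "homogeneous (mdeg m) (Poly_Mapping.single m v)"
  by (auto simp: homogeneous_iff_lookup lookup_single when_def)

lemma homogeneous_unique: "homogeneous i p \<Longrightarrow> homogeneous j p \<Longrightarrow> p \<noteq> 0 \<Longrightarrow> i = j"
  by (metis hom_part_homogeneous)

text \<open>Summands of a form need not be forms, so the induction runs on
  \<open>hom_part k p\<close>, which equals \<open>p\<close>; terms of other degrees become
  0.\<close>

lemma homogeneous_induct [consumes 1, case_names single add]:
  assumes "homogeneous k p" and "\<And>m v. mdeg m = k \<Longrightarrow> P (Poly_Mapping.single m v)"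
    and "\<And>p q. P p \<Longrightarrow> P q \<Longrightarrow> P (p + q)" and "P 0"
  shows "P p"
proof -
  have "P (hom_part k p)"
    by (induction p rule: cpoly_induct) (use assms in \<open>auto simp: hom_part_single hom_part_add\<close>)
  then show ?thesis using assms(1) by (simp add: homogeneous_iff_hom_part)
qed

section \<open>Derivatives of forms and Euler's formula\<close>

lemma partials_0 [simp]: "dx 0 = 0" "dy 0 = 0" "dz 0 = 0"
  by (simp_all add: dx_def dy_def dz_def)

lemma homogeneous_dx: "homogeneous k p \<Longrightarrow> homogeneous (k - 1) (dx p)"
proof (induction rule: homogeneous_induct)
  case (single m v)
  obtain a b c where m: "m = (a,b,c)" by (cases m)
  show ?case using single homogeneous_single[of "(a-1,b,c)" "of_nat a * v"]
    by (cases a) (auto simp: m dx_single mdeg_def)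
qed (auto simp: dx_add homogeneous_add)
lemma homogeneous_dy: "homogeneous k p \<Longrightarrow> homogeneous (k - 1) (dy p)"
proof (induction rule: homogeneous_induct)
  case (single m v)
  obtain a b c where m: "m = (a,b,c)" by (cases m)
  show ?case using single homogeneous_single[of "(a,b-1,c)" "of_nat b * v"]
    by (cases b) (auto simp: m dy_single mdeg_def)
qed (auto simp: dy_add homogeneous_add)
lemma homogeneous_dz: "homogeneous k p \<Longrightarrow> homogeneous (k - 1) (dz p)"
proof (induction rule: homogeneous_induct)
  case (single m v)
  obtain a b c where m: "m = (a,b,c)" by (cases m)
  show ?case using single homogeneous_single[of "(a,b,c-1)" "of_nat c * v"]
    by (cases c) (auto simp: m dz_single mdeg_def)
qed (auto simp: dz_add homogeneous_add)

text \<open>On a monomial the three terms multiply it by its three exponents, whose sum is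
  \<open>k\<close>.\<close>

lemma euler_homogeneous:
  assumes "homogeneous k p"
  shows "Poly_Mapping.single (1,0,0) 1 * dx p + Poly_Mapping.single (0,1,0) 1 * dy p
         + Poly_Mapping.single (0,0,1) 1 * dz p = const (of_nat k) * p"
  using assms
proof (induction rule: homogeneous_induct)
  case (single m v)
  obtain a b c where m: "m = (a,b,c)" by (cases m)
  have "of_nat k = (of_nat a + of_nat b + of_nat c :: complex)" using single by (auto simp: m mdeg_def)
  moreover have "Poly_Mapping.single (1,0,0) 1 * dx (Poly_Mapping.single m v) = Poly_Mapping.single m (of_nat a * v)"
    by (cases a) (simp_all add: m dx_single mult_single)
  moreover have "Poly_Mapping.single (0,1,0) 1 * dy (Poly_Mapping.single m v) = Poly_Mapping.single m (of_nat b * v)"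
    by (cases b) (simp_all add: m dy_single mult_single)
  moreover have "Poly_Mapping.single (0,0,1) 1 * dz (Poly_Mapping.single m v) = Poly_Mapping.single m (of_nat c * v)"
    by (cases c) (simp_all add: m dz_single mult_single)
  ultimately show ?case by (simp add: const_single distrib_right flip: single_add)
next
  case (add p q)
  show ?case unfolding dx_add dy_add dz_add distrib_left[of "const _"] add[symmetric]
    by (simp add: algebra_simps)
qed simp

subsection \<open>Unique factorization\<close>

text \<open>Iterated univariate polynomials over a field carry the library's gcd and prime factorization.\<close>

definition to_poly :: "cpoly \<Rightarrow> complex poly poly poly" where
  "to_poly p = (\<Sum>m\<in>Poly_Mapping.keys p. case m of (a,b,c) \<Rightarrow>
     monom (monom (monom (Poly_Mapping.lookup p m) a) b) c)"

lemma to_poly_add: "to_poly (p + q) = to_poly p + to_poly q"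
  unfolding to_poly_def by (rule setsum_keys_plus_distrib) (auto simp: add_monom)

lemma to_poly_single: "to_poly (Poly_Mapping.single (a,b,c) v) = monom (monom (monom v a) b) c"
  by (cases "v = 0") (simp_all add: to_poly_def)

text \<open>The variable z is outermost, so exponents are read in the order \<open>c\<close>,
  \<open>b\<close>, \<open>a\<close>; injectivity of \<open>to_poly\<close> follows.\<close>

lemma coeff_to_poly:
  "poly.coeff (poly.coeff (poly.coeff (to_poly p) c) b) a = Poly_Mapping.lookup p (a,b,c)"
proof (induction p rule: cpoly_induct)
  case (single m v)
  then show ?case by (cases m) (auto simp: to_poly_single lookup_single when_def)
qed (auto simp: to_poly_add lookup_add)

lemma to_poly_mult: "to_poly (p * q) = to_poly p * to_poly q"
proof (induction p rule: cpoly_induct)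
  case (single m v)
  show ?case
  proof (induction q rule: cpoly_induct)
    case (single n w)
    show ?case by (cases m; cases n) (simp add: mult_single to_poly_single mult_monom)
  qed (simp add: algebra_simps to_poly_add)
qed (simp add: algebra_simps to_poly_add)

lemma to_poly_1: "to_poly 1 = 1"
proof -
  have "to_poly (Poly_Mapping.single (0,0,0) 1) = 1" unfolding to_poly_single by (simp add: monom_0 flip: one_pCons)
  then show ?thesis by (simp flip: zero_prod_def)
qed

lemma to_poly_0: "to_poly 0 = 0" by (simp add: to_poly_def)

lemma inj_to_poly: "inj to_poly"
proof (rule injI, rule poly_mapping_eqI)
  fix p q m assume "to_poly p = to_poly q"
  then show "Poly_Mapping.lookup p m = Poly_Mapping.lookup q m"
    using coeff_to_poly by (cases m) metis
qed

lemma poly_monom_induct [case_names monom add]: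
  assumes "\<And>v a. P (monom v a)" and "\<And>p q. P p \<Longrightarrow> P q \<Longrightarrow> P (p + q)"
  shows "P p"
proof -
  have "P (\<Sum>i\<in>A. monom (poly.coeff p i) i)" if "finite A" for A
    using that by (induction A) (use assms assms(1)[of 0 0] in auto)
  then show ?thesis using poly_as_sum_of_monoms[of p] by (metis finite_atMost)
qed

text \<open>One induction over monomials for each of the three variables.\<close>

lemma surj_to_poly: "\<exists>p. to_poly p = P"
proof (induction P rule: poly_monom_induct)
  case (monom Q c)
  show ?case
  proof (induction Q rule: poly_monom_induct)
    case (monom R b)
    show ?case
    proof (induction R rule: poly_monom_induct)
      case (monom v a)
      then show ?case using to_poly_single by blast
    qed (metis add_monom to_poly_add)
  qed (metis add_monom to_poly_add)
qed (metis to_poly_add)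

lemma to_poly_eq_iff [simp]: "to_poly p = to_poly q \<longleftrightarrow> p = q"
  using inj_to_poly by (auto dest: injD)

lemma to_poly_eq_0_iff [simp]: "to_poly p = 0 \<longleftrightarrow> p = 0"
  using to_poly_eq_iff[of p 0] by (simp add: to_poly_0)

lemma to_poly_dvd_iff [simp]: "to_poly p dvd to_poly q \<longleftrightarrow> p dvd q"
  unfolding dvd_def by (metis surj_to_poly to_poly_eq_iff to_poly_mult)

lemma cpoly_mult_eq_0_iff [simp]: "p * q = 0 \<longleftrightarrow> p = 0 \<or> q = (0 :: cpoly)"
  by (simp flip: to_poly_eq_0_iff add: to_poly_mult)

lemma prime_elem_to_poly_iff: "prime_elem (to_poly p) \<longleftrightarrow> prime_elem p"
proof -
  have "(\<forall>a b. to_poly p dvd a * b \<longrightarrow> to_poly p dvd a \<or> to_poly p dvd b) \<longleftrightarrow>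
        (\<forall>a b. to_poly p dvd to_poly a * to_poly b \<longrightarrow> to_poly p dvd to_poly a \<or> to_poly p dvd to_poly b)"
    by (metis surj_to_poly)
  then show ?thesis
    unfolding prime_elem_def by (simp flip: to_poly_mult to_poly_1)
qed

lemma cpoly_prime_divisor:
  assumes "(h :: cpoly) \<noteq> 0" "\<not> h dvd 1"
  shows "\<exists>g. prime_elem g \<and> g dvd h"
proof -
  have "\<not> is_unit (to_poly h)" using assms(2) to_poly_dvd_iff[of h 1] by (simp add: to_poly_1)
  then obtain P where P: "prime P" "P dvd to_poly h"
    using assms(1) prime_divisor_exists[of "to_poly h"] by auto
  obtain g where "to_poly g = P" using surj_to_poly by blast
  then show ?thesis using P by (metis prime_elem_to_poly_iff prime_imp_prime_elem to_poly_dvd_iff)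
qed

text \<open>Here \<open>h\<close> is a greatest common divisor. Coprimality of the cofactors is
  recorded as Euclid's lemma, the only form in which it is applied to syzygies.\<close>

lemma cpoly_gcd:
  assumes "(p :: cpoly) \<noteq> 0" "q \<noteq> 0"
  shows "\<exists>h a b. p = h * a \<and> q = h * b \<and> (\<forall>u v. a * u = b * v \<longrightarrow> a dvd v)"
proof -
  define H where "H = gcd (to_poly p) (to_poly q)"
  have "H \<noteq> 0" using assms by (simp add: H_def)
  then obtain A B where A: "to_poly p = A * H" and B: "to_poly q = B * H" and cop: "coprime A B"
    unfolding H_def using gcd_coprime_exists by blast
  obtain h a b where h: "to_poly h = H" "to_poly a = A" "to_poly b = B" using surj_to_poly by metis
  have "a dvd v" if "a * u = b * v" for u v
  proof -
    have "A * to_poly u = B * to_poly v" using that h by (metis to_poly_mult)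
    then have "A dvd B * to_poly v" by (metis dvd_triv_left)
    then have "A dvd to_poly v" using cop by (simp add: coprime_dvd_mult_right_iff)
    then show ?thesis using h by auto
  qed
  moreover have "p = h * a" "q = h * b" using A B h by (metis mult.commute to_poly_eq_iff to_poly_mult)+
  ultimately show ?thesis by blast
qed

subsection \<open>Reduced forms\<close>

lemma hom_part_eq_0_iff: "hom_part n p = 0 \<longleftrightarrow> n \<notin> mdeg ` Poly_Mapping.keys p"
  by (auto simp: poly_mapping_eq_iff fun_eq_iff in_keys_iff split: if_splits)

text \<open>The lowest components of the factors multiply to a nonzero component of the product, and
  so do the highest; both products have degree \<open>d\<close>, so lowest and highest degree agree
  in each factor.\<close>

lemma homogeneous_factor:
  assumes f: "homogeneous d (p * q)" and "p * q \<noteq> 0"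
  shows "\<exists>i. homogeneous i p"
proof -
  define P where "P = mdeg ` Poly_Mapping.keys p"
  define Q where "Q = mdeg ` Poly_Mapping.keys q"
  have fin: "finite P" "finite Q" by (auto simp: P_def Q_def)
  have ne: "P \<noteq> {}" "Q \<noteq> {}" using assms(2) by (auto simp: P_def Q_def)
  have hp: "hom_part n p \<noteq> 0 \<longleftrightarrow> n \<in> P" and hq: "hom_part n q \<noteq> 0 \<longleftrightarrow> n \<in> Q" for n
    by (simp_all add: P_def Q_def hom_part_eq_0_iff)
  \<comment> \<open>If only one pair of component degrees adds up to \<open>i + j\<close>, nothing
    can cancel in that degree of the product.\<close>
  have deg: "i + j = d" if "i \<in> P" "j \<in> Q" "\<And>a. a \<le> i + j \<Longrightarrow> a \<in> P \<Longrightarrow> i + j - a \<in> Q \<Longrightarrow> a = i" for i j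
  proof -
    have "hom_part (i + j) (p * q) = (\<Sum>a\<le>i+j. if a = i then hom_part i p * hom_part j q else 0)"
      unfolding hom_part_mult by (rule sum.cong) (use that(3) hp hq in \<open>auto\<close>)
    then have "hom_part (i + j) (p * q) \<noteq> 0" using that hp hq by simp
    then show ?thesis using hom_part_homogeneous[OF f] by metis
  qed
  have 1: "Min P + Min Q = d"
  proof (rule deg)
    show "a = Min P" if "a \<in> P" "Min P + Min Q - a \<in> Q" "a \<le> Min P + Min Q" for a
      using Min_le[OF fin(1) that(1)] Min_le[OF fin(2) that(2)] that(3) by linarith
  qed (use fin ne in auto)
  have 2: "Max P + Max Q = d"
  proof (rule deg)
    show "a = Max P" if "a \<in> P" "Max P + Max Q - a \<in> Q" "a \<le> Max P + Max Q" for a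
      using Max_ge[OF fin(1) that(1)] Max_ge[OF fin(2) that(2)] that(3) by linarith
  qed (use fin ne in auto)
  have "Min P \<le> Max P" "Min Q \<le> Max Q" using fin ne by auto
  then have "Min P = Max P" using 1 2 by linarith
  then have "\<forall>n\<in>P. n = Min P" using fin by (metis Max_ge Min_le antisym)
  then show ?thesis unfolding homogeneous_def P_def by blast
qed

lemma const_dvd_1: "c \<noteq> 0 \<Longrightarrow> const c dvd 1"
  by (rule dvdI[of _ _ "const (1 / c)"]) (simp add: const_mult[symmetric])

text \<open>Multiples of \<open>g\<close> have no components below degree \<open>e\<close>;
  \<open>e \<ge> 1\<close> makes \<open>e - 1\<close> really smaller.\<close>

lemma dvd_lower_degree:
  assumes "homogeneous e g" "homogeneous (e - 1) p" "g dvd p" "e \<ge> 1"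
  shows "p = 0"
proof -
  obtain u where u: "p = u * g" using assms(3) by (metis dvdE mult.commute)
  have "hom_part (e - 1) (u * g) = 0" using assms(4) by (subst hom_part_mult_homogeneous[OF assms(1)]) auto
  then show ?thesis using assms(2) u by (simp add: homogeneous_iff_hom_part)
qed

text \<open>By Euler's formula \<open>g\<close> divides \<open>f = g * k\<close>, and
  \<open>f\<close> being reduced, \<open>g\<close> does not divide \<open>k\<close>. The Leibniz
  rule then makes \<open>g\<close> divide its own partial derivatives, which vanish for degree
  reasons, against Euler's formula for \<open>g\<close>.\<close>

lemma reduced_no_common_prime:
  assumes red: "reduced f" and hom: "homogeneous d f" and "d \<ge> 1" and g: "prime_elem g"
    and dvd: "g dvd dx f" "g dvd dy f" "g dvd dz f"
  shows False
proof -
  have nu: "\<not> g dvd 1" and g0: "g \<noteq> 0" using g by (auto simp: prime_elem_def)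
  have "g dvd const (of_nat d) * f"
    unfolding euler_homogeneous[OF hom, symmetric] using dvd by (intro dvd_add dvd_mult)
  then have "g dvd const (1 / of_nat d) * (const (of_nat d) * f)" by (rule dvd_mult)
  also have "\<dots> = f" using \<open>d \<ge> 1\<close>
    by (simp only: mult.assoc[symmetric] const_mult[symmetric]) simp
  finally obtain k where k: "f = g * k" by blast
  have f0: "f \<noteq> 0" using red by (simp add: reduced_def)
  obtain e where e: "homogeneous e g" using homogeneous_factor[of d g k] hom f0 k by auto
  have ncst: "g \<noteq> const c" for c using nu g0 const_dvd_1[of c] by (cases "c = 0") auto
  have "e \<noteq> 0" using e homogeneous_0D ncst by metis
  have "\<not> g dvd k"
  proof
    assume "g dvd k"
    then have "g * g dvd f" using k by (simp add: mult_dvd_mono)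
    then show False using red ncst by (auto simp: reduced_def)
  qed
  then have cancel: "g dvd p" if "g dvd p * k + g * q" for p q
    using that g by (metis dvd_add_left_iff dvd_triv_left prime_elem_dvd_mult_iff)
  have "g dvd dx g" "g dvd dy g" "g dvd dz g"
    using dvd unfolding k dx_mult dy_mult dz_mult by (simp_all only: cancel)
  then have "dx g = 0" "dy g = 0" "dz g = 0"
    using dvd_lower_degree[OF e homogeneous_dx[OF e]] dvd_lower_degree[OF e homogeneous_dy[OF e]]
      dvd_lower_degree[OF e homogeneous_dz[OF e]] \<open>e \<noteq> 0\<close> by (meson less_one not_le)+
  then have "const (of_nat e) * g = 0" using euler_homogeneous[OF e] by simp
  then show False using g0 \<open>e \<noteq> 0\<close> by simp
qed

subsection \<open>Finite-dimensional subspaces\<close>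

text \<open>Inside the locale the names are qualified by \<open>local\<close> because the global interpretation
  for real vector spaces shadows new ones.\<close>

context vector_space
begin

text \<open>A relation instead of the function \<open>dim\<close>, so that every dimension statement
  includes finite dimensionality.\<close>

definition has_dim :: "'b set \<Rightarrow> nat \<Rightarrow> bool" where
  "has_dim V n \<longleftrightarrow> (\<exists>B. finite B \<and> independent B \<and> span B = V \<and> card B = n)"

lemma has_dim_subspace: "local.has_dim V n \<Longrightarrow> subspace V"
  by (auto simp: local.has_dim_def)

lemma independent_in_has_dim:
  assumes "local.has_dim V n" "independent S" "S \<subseteq> V"
  shows "finite S" "card S \<le> n"
  using assms independent_span_bound unfolding local.has_dim_def by blast+

lemma has_dimI: "independent B \<Longrightarrow> span B = V \<Longrightarrow> local.has_dim V n \<Longrightarrow> card B = n"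
  by (metis local.has_dim_def dim_span_eq_card_independent)

lemma has_dim_unique: "local.has_dim V n \<Longrightarrow> local.has_dim V k \<Longrightarrow> n = k"
  by (metis local.has_dim_def dim_span_eq_card_independent)

lemma has_dim_sub:
  assumes "local.has_dim V n" "subspace W" "W \<subseteq> V"
  shows "\<exists>k\<le>n. local.has_dim W k"
proof -
  obtain B where B: "B \<subseteq> W" "independent B" "W \<subseteq> span B" using maximal_independent_subset by blast
  then have "span B = W" using assms(2) by (metis span_subspace)
  moreover have "finite B" "card B \<le> n"
    using local.independent_in_has_dim[OF assms(1) B(2)] B(1) assms(3) by auto
  ultimately show ?thesis using B(2) by (auto simp: local.has_dim_def)
qed

lemma has_dim_mono: "local.has_dim V n \<Longrightarrow> local.has_dim W k \<Longrightarrow> W \<subseteq> V \<Longrightarrow> k \<le> n"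
  by (metis local.has_dim_sub local.has_dim_subspace local.has_dim_unique)

lemma has_dim_trivial: "local.has_dim {0} 0"
  unfolding local.has_dim_def by (rule exI[of _ "{}"]) (simp add: independent_empty)

text \<open>A basis \<open>C\<close> of \<open>W\<close> is extended to one of \<open>V\<close>; the
  added vectors \<open>D\<close> span a complement, which serves for kernels and for quotients
  alike.\<close>

lemma subspace_complement_basis:
  assumes "subspace V" "subspace W" "W \<subseteq> V"
  obtains C D where "C \<inter> D = {}" "independent (C \<union> D)" "span (C \<union> D) = V" "span C = W"
proof -
  obtain C where C: "C \<subseteq> W" "independent C" "W \<subseteq> span C" using maximal_independent_subset by blast
  have sC: "span C = W" using C assms(2) by (metis span_subspace)
  obtain B where B: "C \<subseteq> B" "B \<subseteq> V" "independent B" "V \<subseteq> span B"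
    using maximal_independent_subset_extend[of C V] C assms(3) by blast
  have "span B = V" using B assms(1) by (metis span_subspace)
  show thesis
    by (rule that[of C "B - C"]) (use B sC \<open>span B = V\<close> in \<open>auto simp: Un_absorb1\<close>)
qed

text \<open>The coordinates of \<open>x\<close> in the joint basis are supported in \<open>C\<close>
  and also in \<open>D\<close>.\<close>

lemma independent_Un_Int_span:
  assumes "independent (C \<union> D)" "C \<inter> D = {}" "x \<in> span C" "x \<in> span D"
  shows "x = 0"
proof -
  have iC: "independent C" and iD: "independent D" using assms(1) independent_mono by blast+
  have "representation (C \<union> D) x = representation C x"
    using assms iC by (intro representation_extend) auto
  moreover have "representation (C \<union> D) x = representation D x"
    using assms iD by (intro representation_extend) auto
  ultimately have "representation C x b = 0" for b
    using representation_ne_zero[of C x b] representation_ne_zero[of D x b] assms(2) by auto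
  then show ?thesis using sum_nonzero_representation_eq[OF iC assms(3)] by simp
qed

end

context vector_space_pair
begin

text \<open>Take for \<open>C\<close> a basis of the kernel on \<open>V\<close>. The span of the
  complement \<open>D\<close> meets the kernel only in 0, so \<open>f\<close> carries
  \<open>D\<close> to a basis of the image.\<close>

lemma linear_complement_basis:
  assumes lin: "Vector_Spaces.linear s1 s2 f" and V: "vs1.subspace V"
  obtains C D where "C \<inter> D = {}" "vs1.independent (C \<union> D)" "vs1.span (C \<union> D) = V"
    "vs1.span C = {x \<in> V. f x = 0}" "vs2.independent (f ` D)" "inj_on f D" "vs2.span (f ` D) = f ` V"
proof -
  have "vs1.subspace (V \<inter> {x. f x = 0})"
    using V linear_subspace_kernel[OF lin] vs1.subspace_inter by blast
  then have "vs1.subspace {x \<in> V. f x = 0}" by (simp only: Int_def mem_Collect_eq)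
  from vs1.subspace_complement_basis[OF V this]
  obtain C D where CD: "C \<inter> D = {}" "vs1.independent (C \<union> D)" "vs1.span (C \<union> D) = V"
    "vs1.span C = {x \<in> V. f x = 0}" by blast
  have "x = 0" if "x \<in> vs1.span D" "f x = 0" for x
  proof -
    have "x \<in> V" using that(1) CD(3) vs1.span_mono[of D "C \<union> D"] by auto
    then have "x \<in> vs1.span C" using CD(4) that by auto
    then show ?thesis using vs1.independent_Un_Int_span[OF CD(2,1)] that by blast
  qed
  then have inj: "inj_on f (vs1.span D)"
    using linear_inj_on_iff_eq_0[OF lin, of "vs1.span D"] by auto
  have "vs1.independent D" using CD(2) vs1.independent_mono by blast
  then have "vs2.independent (f ` D)" using linear_independent_injective_image[OF lin] inj by blast
  moreover have "inj_on f D" using inj vs1.span_superset inj_on_subset by blast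
  moreover have "vs2.span (f ` D) = f ` V"
  proof -
    have "f ` V = f ` vs1.span D"
    proof
      show "f ` vs1.span D \<subseteq> f ` V" using CD(3) vs1.span_mono[of D "C \<union> D"] by auto
      show "f ` V \<subseteq> f ` vs1.span D"
      proof clarify
        fix x assume "x \<in> V"
        then obtain c y where x: "x = c + y" "c \<in> vs1.span C" "y \<in> vs1.span D"
          unfolding CD(3)[symmetric] vs1.span_Un by auto
        have "f x = f y" using x(2) CD(4) unfolding x(1) linear_add[OF lin] by simp
        then show "f x \<in> f ` vs1.span D" using x by blast
      qed
    qed
    then show ?thesis using linear_span_image[OF lin] by simp
  qed
  ultimately show thesis using that CD by blast
qed

text \<open>Stated on a subspace because the maps below are defined on infinite-dimensional spaces
  and only restricted to graded pieces.\<close>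

lemma rank_nullity:
  assumes lin: "Vector_Spaces.linear s1 s2 f" and V: "vs1.has_dim V n"
  shows "\<exists>a b. vs2.has_dim (f ` V) a \<and> vs1.has_dim {x \<in> V. f x = 0} b \<and> a + b = n"
proof -
  obtain C D where CD: "C \<inter> D = {}" "vs1.independent (C \<union> D)" "vs1.span (C \<union> D) = V"
    "vs1.span C = {x \<in> V. f x = 0}" "vs2.independent (f ` D)" "inj_on f D" "vs2.span (f ` D) = f ` V"
    using linear_complement_basis[OF lin vs1.has_dim_subspace[OF V]] by blast
  have fin: "finite (C \<union> D)"
    using vs1.independent_in_has_dim[OF V CD(2)] CD(3) vs1.span_superset by blast
  have "card (C \<union> D) = n" using vs1.has_dimI[OF CD(2,3) V] .
  then have "card C + card D = n" using fin CD(1) by (simp add: card_Un_disjoint)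
  moreover have "vs1.independent C" using CD(2) vs1.independent_mono by blast
  moreover have "card (f ` D) = card D" using CD(6) by (rule card_image)
  ultimately have "vs1.has_dim {x \<in> V. f x = 0} (card C)" "vs2.has_dim (f ` V) (card D)"
    unfolding vs1.has_dim_def vs2.has_dim_def using fin CD(4,5,7) by (metis finite_Un finite_imageI)+
  then show ?thesis using \<open>card C + card D = n\<close> by (metis add.commute)
qed

text \<open>Finite dimensionality of \<open>V\<close> is a conclusion here, which suits the
  induction on the length of tuples.\<close>

lemma has_dim_of_image_kernel:
  assumes lin: "Vector_Spaces.linear s1 s2 f" and V: "vs1.subspace V"
    and "vs2.has_dim (f ` V) a" "vs1.has_dim {x \<in> V. f x = 0} b"
  shows "vs1.has_dim V (a + b)"
proof -
  obtain C D where CD: "C \<inter> D = {}" "vs1.independent (C \<union> D)" "vs1.span (C \<union> D) = V"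
    "vs1.span C = {x \<in> V. f x = 0}" "vs2.independent (f ` D)" "inj_on f D" "vs2.span (f ` D) = f ` V"
    using linear_complement_basis[OF lin V] by blast
  have "finite (f ` D)" using vs2.independent_in_has_dim[OF assms(3) CD(5)] CD(7) vs2.span_superset by blast
  then have fD: "finite D" using CD(6) finite_imageD by blast
  have iC: "vs1.independent C" using CD(2) vs1.independent_mono by blast
  have fC: "finite C" using vs1.independent_in_has_dim[OF assms(4) iC] CD(4) vs1.span_superset by blast
  have "card (f ` D) = a" using vs2.has_dimI[OF CD(5,7) assms(3)] .
  then have "card D = a" using CD(6) by (simp add: card_image)
  moreover have "card C = b" using vs1.has_dimI[OF iC CD(4) assms(4)] .
  ultimately have "card (C \<union> D) = a + b" using fC fD CD(1) by (simp add: card_Un_disjoint)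
  then show ?thesis using fC fD CD(2,3) unfolding vs1.has_dim_def by (metis finite_Un)
qed

end

subsection \<open>Dimensions of spaces of forms\<close>

definition tscale :: "complex \<Rightarrow> (nat \<Rightarrow> cpoly) \<Rightarrow> nat \<Rightarrow> cpoly" where
  "tscale c h = (\<lambda>j. const c * h j)"

interpretation P: vector_space smul
  by standard (simp_all add: smul_def const_add const_mult algebra_simps)

interpretation T: vector_space tscale
  by standard (simp_all add: tscale_def const_add const_mult algebra_simps fun_eq_iff)

interpretation TP: vector_space_pair tscale smul ..
interpretation TT: vector_space_pair tscale tscale ..

text \<open>The binomial coefficient of \<open>k + 2\<close> over 2, the number of monomials of
  degree \<open>k\<close> in three variables.\<close>

definition form_dim :: "nat \<Rightarrow> nat" where
  "form_dim k = (k + 1) * (k + 2) div 2"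

lemma form_dim_double: "2 * form_dim k = (k + 1) * (k + 2)"
  unfolding form_dim_def by (simp add: dvd_mult_div_cancel)

lemma form_dim_Suc: "form_dim (Suc k) = form_dim k + (k + 2)"
  using form_dim_double[of k] form_dim_double[of "Suc k"] by (simp add: algebra_simps)

lemma mdeg_set_eq:
  "{m. mdeg m = k} = (\<lambda>(a, b). (a, b, k - a - b)) ` (SIGMA a:{..k}. {..k - a})" (is "_ = ?R")
proof
  show "{m. mdeg m = k} \<subseteq> ?R"
  proof
    fix m assume m: "m \<in> {m. mdeg m = k}"
    obtain a b c where abc: "m = (a,b,c)" by (cases m)
    have "m = (\<lambda>(a, b). (a, b, k - a - b)) (a, b)" "(a,b) \<in> (SIGMA a:{..k}. {..k - a})"
      using m abc by (auto simp: mdeg_def)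
    then show "m \<in> ?R" by (rule image_eqI)
  qed
qed (auto simp: mdeg_def)

lemma finite_mdeg: "finite {m. mdeg m = k}"
  unfolding mdeg_set_eq by auto

lemma card_mdeg: "card {m. mdeg m = k} = form_dim k"
proof -
  \<comment> \<open>For a fixed exponent \<open>a\<close> of x there are \<open>k - a + 1\<close>
    exponents of y, and the exponent of z is then determined.\<close>
  have "(\<Sum>a\<le>k. Suc (k - a)) = (\<Sum>i\<le>k. Suc i)"
    by (rule sum.reindex_bij_witness[of _ "\<lambda>i. k - i" "\<lambda>i. k - i"]) auto
  also have "\<dots> = form_dim k" by (induction k) (simp_all add: form_dim_Suc, simp add: form_dim_def)
  finally show ?thesis unfolding mdeg_set_eq
    by (subst card_image) (auto simp: inj_on_def)
qed

lemma subspace_homogeneous: "P.subspace {p. homogeneous k p}"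
  by (rule P.subspaceI) (auto simp: homogeneous_add smul_def)

lemma has_dim_homogeneous: "P.has_dim {p. homogeneous k p} (form_dim k)"
proof -
  let ?s = "\<lambda>m. Poly_Mapping.single m (1 :: complex)"
  let ?M = "{m. mdeg m = k}"
  have inj: "inj_on ?s ?M" by (rule inj_onI) (metis keys_single one_neq_zero the_elem_eq)
  have "P.independent (?s ` ?M)"
  proof (rule P.independent_if_scalars_zero)
    fix u x assume 0: "(\<Sum>x\<in>?s ` ?M. smul (u x) x) = 0" and "x \<in> ?s ` ?M"
    then obtain m where m: "x = ?s m" "mdeg m = k" by auto
    have "0 = Poly_Mapping.lookup (\<Sum>x\<in>?s ` ?M. smul (u x) x) m" unfolding 0 by simp
    also have "\<dots> = (\<Sum>n\<in>?M. u (?s n) * Poly_Mapping.lookup (?s n) m)"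
      by (simp add: sum.reindex[OF inj] smul_def lookup_sum)
    also have "\<dots> = (\<Sum>n\<in>?M. if n = m then u x else 0)"
      by (rule sum.cong) (auto simp: lookup_single when_def m)
    finally show "u x = 0" using m(2) finite_mdeg by simp
  qed (simp add: finite_mdeg)
  moreover have "P.span (?s ` ?M) = {p. homogeneous k p}"
  proof
    show "P.span (?s ` ?M) \<subseteq> {p. homogeneous k p}"
      by (rule P.span_minimal[OF _ subspace_homogeneous]) (auto simp: homogeneous_single)
    show "{p. homogeneous k p} \<subseteq> P.span (?s ` ?M)"
    proof clarify
      fix p assume p: "homogeneous k p"
      have "p = (\<Sum>m\<in>Poly_Mapping.keys p. smul (Poly_Mapping.lookup p m) (?s m))"
        by (subst cpoly_sum_singles) (simp add: smul_def const_single)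
      moreover have "\<dots> \<in> P.span (?s ` ?M)"
        using p by (intro P.span_sum P.span_scale P.span_base) (auto simp: homogeneous_def)
      ultimately show "p \<in> P.span (?s ` ?M)" by simp
    qed
  qed
  ultimately show ?thesis unfolding P.has_dim_def
    using card_mdeg[of k] finite_mdeg[of k] card_image[OF inj] by (intro exI[of _ "?s ` ?M"]) simp
qed

section \<open>Tuples of forms and matrices acting on them\<close>

text \<open>Entries from \<open>n\<close> on are pinned to 0; otherwise the space would not be
  finite-dimensional.\<close>

definition tuples :: "nat \<Rightarrow> (nat \<Rightarrow> nat) \<Rightarrow> (nat \<Rightarrow> cpoly) set" where
  "tuples n e = {h. (\<forall>j<n. homogeneous (e j) (h j)) \<and> (\<forall>j\<ge>n. h j = 0)}"

lemma subspace_tuples: "T.subspace (tuples n e)"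
  by (rule T.subspaceI) (auto simp: tuples_def homogeneous_add tscale_def)

lemma linear_component: "Vector_Spaces.linear tscale smul (\<lambda>h. h n)"
  by (simp add: Vector_Spaces.linear_iff T.vector_space_axioms P.vector_space_axioms tscale_def smul_def)

text \<open>Projection to the last entry has the forms of degree \<open>e n\<close> as image and the
  shorter tuples as kernel.\<close>

lemma has_dim_tuples: "T.has_dim (tuples n e) (\<Sum>j<n. form_dim (e j))"
proof (induction n)
  case 0
  have "tuples 0 e = {0}" by (auto simp: tuples_def fun_eq_iff)
  then show ?case using T.has_dim_trivial by simp
next
  case (Suc n)
  have "(\<lambda>h. h n) ` tuples (Suc n) e = {p. homogeneous (e n) p}"
  proof
    show "{p. homogeneous (e n) p} \<subseteq> (\<lambda>h. h n) ` tuples (Suc n) e"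
    proof clarify
      fix p assume "homogeneous (e n) p"
      then show "p \<in> (\<lambda>h. h n) ` tuples (Suc n) e"
        by (intro image_eqI[of _ _ "\<lambda>j. if j = n then p else 0"]) (auto simp: tuples_def)
    qed
  qed (auto simp: tuples_def)
  moreover have "{h \<in> tuples (Suc n) e. h n = 0} = tuples n e"
    by (auto simp: tuples_def less_Suc_eq le_Suc_eq Suc_le_eq) (metis le_neq_implies_less)
  ultimately show ?case
    using TP.has_dim_of_image_kernel[OF linear_component subspace_tuples[of "Suc n" e],
        where n1 = n and a = "form_dim (e n)" and b = "\<Sum>j<n. form_dim (e j)"] Suc has_dim_homogeneous[of "e n"]
    by (simp add: add.commute)
qed

text \<open>The row vector \<open>h\<close> times the matrix \<open>A\<close>, padded with zeros
  from column \<open>p\<close> on so that the values are again tuples.\<close>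

definition mat_map :: "nat \<Rightarrow> nat \<Rightarrow> (nat \<Rightarrow> nat \<Rightarrow> cpoly) \<Rightarrow> (nat \<Rightarrow> cpoly) \<Rightarrow> nat \<Rightarrow> cpoly" where
  "mat_map n p A h = (\<lambda>i. if i < p then \<Sum>j<n. h j * A j i else 0)"

lemma linear_mat_map: "Vector_Spaces.linear tscale tscale (mat_map n p A)"
  by (simp add: Vector_Spaces.linear_iff T.vector_space_axioms tscale_def mat_map_def fun_eq_iff
      sum.distrib sum_distrib_left algebra_simps)

lemma linear_comb: "Vector_Spaces.linear tscale smul (\<lambda>h. \<Sum>j<n. h j * A j)"
  by (simp add: Vector_Spaces.linear_iff T.vector_space_axioms P.vector_space_axioms tscale_def smul_def
      sum.distrib sum_distrib_left algebra_simps)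

subsection \<open>Graded pieces of the resolution\<close>

text \<open>Let \<open>C\<close> be a basis of the degree \<open>k\<close> part of \<open>W\<close>
  and \<open>D\<close> its complement. Then \<open>D\<close> is independent modulo \<open>W\<close>,
  and any competitor \<open>B\<close> is disjoint from \<open>C\<close> and independent together
  with it, so it has at most \<open>card D\<close> elements.\<close>

lemma quot_dim_eq:
  assumes W: "P.subspace W" and n: "P.has_dim (W \<inter> {p. homogeneous k p}) n"
  shows "n \<le> form_dim k" "quot_dim W k = form_dim k - n"
proof -
  let ?K = "{card B |B. B \<subseteq> {p. homogeneous k p} \<and> lin_indep_mod W B}"
  let ?V = "{p. homogeneous k p}"
  obtain C D where CD: "C \<inter> D = {}" "P.independent (C \<union> D)" "P.span (C \<union> D) = ?V"
    "P.span C = W \<inter> ?V"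
    using P.subspace_complement_basis[OF subspace_homogeneous P.subspace_inter[OF W subspace_homogeneous]]
    by blast
  have fin: "finite C" "finite D"
    using P.independent_in_has_dim[OF has_dim_homogeneous CD(2)] CD(3) P.span_superset by blast+
  have iC: "P.independent C" and iD: "P.independent D"
    using CD(2) P.independent_mono by blast+
  have cC: "card C = n" using P.has_dimI[OF iC CD(4) n] .
  have "card (C \<union> D) = form_dim k" using P.has_dimI[OF CD(2,3) has_dim_homogeneous] .
  then have card: "n + card D = form_dim k" using fin CD(1) cC by (simp add: card_Un_disjoint)
  then show "n \<le> form_dim k" by simp
  have CV: "C \<subseteq> W \<inter> ?V" using CD(4) P.span_superset by blast
  have DV: "D \<subseteq> ?V" using CD(3) P.span_superset by blast
  have "lin_indep_mod W D"
    unfolding lin_indep_mod_def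
  proof (intro conjI allI impI)
    fix c assume W': "(\<Sum>p\<in>D. smul (c p) p) \<in> W"
    have D': "(\<Sum>p\<in>D. smul (c p) p) \<in> P.span D"
      by (intro P.span_sum P.span_scale P.span_base)
    moreover have "P.span D \<subseteq> ?V" using DV subspace_homogeneous by (rule P.span_minimal)
    ultimately have "(\<Sum>p\<in>D. smul (c p) p) \<in> P.span C" using W' CD(4) by blast
    then have "(\<Sum>p\<in>D. smul (c p) p) = 0" using P.independent_Un_Int_span[OF CD(2,1) _ D'] by blast
    then show "\<forall>p\<in>D. c p = 0" using P.independentD[OF iD fin(2)] by blast
  qed (rule fin)
  moreover have "card B \<le> card D" if "B \<subseteq> ?V" "lin_indep_mod W B" for B
  proof -
    have fB: "finite B" and B: "\<And>c. (\<Sum>p\<in>B. smul (c p) p) \<in> W \<Longrightarrow> \<forall>p\<in>B. c p = 0"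
      using that(2) by (auto simp: lin_indep_mod_def)
    \<comment> \<open>A common element would itself be a combination of \<open>B\<close> lying in
      \<open>W\<close>, with coefficient 1.\<close>
    have disj: "B \<inter> C = {}"
    proof (rule ccontr)
      assume "B \<inter> C \<noteq> {}"
      then obtain x where x: "x \<in> B" "x \<in> C" by blast
      have "(\<Sum>p\<in>B. smul (if p = x then 1 else 0) p) = (\<Sum>p\<in>B. if p = x then x else 0)"
        by (rule sum.cong) (auto simp: smul_def)
      also have "\<dots> = x" using x(1) fB by simp
      finally have "(\<Sum>p\<in>B. smul (if p = x then 1 else 0) p) \<in> W" using x(2) CV by auto
      from B[OF this] x(1) show False by auto
    qed
    have "P.independent (B \<union> C)"
    proof (rule P.independent_if_scalars_zero)
      fix u x assume 0: "(\<Sum>x\<in>B \<union> C. smul (u x) x) = 0" and x: "x \<in> B \<union> C"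
      have s: "(\<Sum>x\<in>B. smul (u x) x) + (\<Sum>x\<in>C. smul (u x) x) = 0"
        using 0 fB fin disj by (simp add: sum.union_disjoint)
      have "(\<Sum>x\<in>C. smul (u x) x) \<in> W"
        using CV by (intro P.subspace_sum[OF W] P.subspace_scale[OF W]) auto
      then have "- (\<Sum>x\<in>C. smul (u x) x) \<in> W" by (rule P.subspace_neg[OF W])
      moreover have e: "(\<Sum>x\<in>B. smul (u x) x) = - (\<Sum>x\<in>C. smul (u x) x)"
        using s by (simp only: eq_neg_iff_add_eq_0)
      ultimately have u: "\<forall>p\<in>B. u p = 0" using B[of u] by simp
      then have "(\<Sum>x\<in>B. smul (u x) x) = 0" by (intro sum.neutral) (auto simp: smul_def)
      then have "(\<Sum>x\<in>C. smul (u x) x) = 0" using s by simp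
      then have "\<forall>p\<in>C. u p = 0" using P.independentD[OF iC fin(1) subset_refl, of u] by blast
      with u show "u x = 0" using x by blast
    qed (use fB fin in simp)
    moreover have "B \<union> C \<subseteq> ?V" using that(1) CV by blast
    ultimately have "card (B \<union> C) \<le> form_dim k" using P.independent_in_has_dim[OF has_dim_homogeneous] by blast
    then show ?thesis using card cC disj fB fin by (simp add: card_Un_disjoint)
  qed
  ultimately have D: "card D \<in> ?K" and le: "\<And>y. y \<in> ?K \<Longrightarrow> y \<le> card D"
    using DV by blast+
  then have "finite ?K" by (meson finite_nat_set_iff_bounded_le)
  then have "quot_dim W k = card D" unfolding quot_dim_def using le D by (rule Max_eqI)
  then show "quot_dim W k = form_dim k - n" using card by simp
qed

text \<open>The three coordinates are numbered 0, 1, 2; every larger index also denotes the last one.\<close>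

definition comp :: "nat \<Rightarrow> vec3 \<Rightarrow> cpoly" where
  "comp i v = (if i = 0 then fst v else if i = 1 then fst (snd v) else snd (snd v))"

lemma lessThan_3: "{..<3::nat} = {0, 1, 2}" by auto

lemma sum_3: "(\<Sum>j<3::nat. g j) = g 0 + g 1 + g (2::nat)" for g :: "nat \<Rightarrow> 'a::comm_monoid_add"
  by (simp add: lessThan_3 add.assoc)

lemma all_3: "(\<forall>i<3::nat. Q i) \<longleftrightarrow> Q 0 \<and> Q 1 \<and> Q (2::nat)"
proof -
  have "(\<forall>i<3. Q i) \<longleftrightarrow> (\<forall>i\<in>{..<3}. Q i)" by auto
  then show ?thesis unfolding lessThan_3 by simp
qed

lemma comp_vsum: "comp i (vsum g n) = (\<Sum>j<n. comp i (g j))"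
  by (simp add: comp_def vsum_def)
lemma comp_vscale: "comp i (vscale h v) = h * comp i v"
  by (simp add: comp_def vscale_def)
lemma vec3_eq_iff: "v = w \<longleftrightarrow> (\<forall>i<3. comp i v = comp i w)"
  by (cases v; cases w) (simp add: all_3 comp_def)
lemma comp_0: "comp i (0,0,0) = 0" by (simp add: comp_def)
lemma vhomogeneous_iff: "vhomogeneous k v \<longleftrightarrow> (\<forall>i. homogeneous k (comp i v))"
  unfolding vhomogeneous_def comp_def by (auto split: if_splits)

section \<open>Syzygies of the gradient and graded pieces of images\<close>

definition gradient :: "cpoly \<Rightarrow> nat \<Rightarrow> cpoly" where
  "gradient f j = comp j (dx f, dy f, dz f)"

lemma homogeneous_gradient: "homogeneous d f \<Longrightarrow> homogeneous (d - 1) (gradient f j)"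
  unfolding gradient_def comp_def using homogeneous_dx homogeneous_dy homogeneous_dz by simp

lemma D0_iff: "v \<in> D0 f \<longleftrightarrow> (\<Sum>j<3. comp j v * gradient f j) = 0"
  by (cases v) (simp add: D0_def sum_3 gradient_def comp_def)

lemma jacobian_ideal_eq: "jacobian_ideal f = range (\<lambda>h. \<Sum>j<3. h j * gradient f j)"
proof (intro set_eqI iffI)
  fix p assume "p \<in> jacobian_ideal f"
  then obtain a b c where p: "p = a * dx f + b * dy f + c * dz f" by (auto simp: jacobian_ideal_def)
  show "p \<in> range (\<lambda>h. \<Sum>j<3. h j * gradient f j)"
    by (rule image_eqI[of _ _ "\<lambda>j. comp j (a,b,c)"]) (simp_all add: p sum_3 gradient_def comp_def)
qed (auto simp: sum_3 jacobian_ideal_def gradient_def comp_def)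

lemma subspace_jacobian: "P.subspace (jacobian_ideal f)"
  unfolding jacobian_ideal_eq using TP.linear_subspace_image[OF linear_comb T.subspace_UNIV] .

lemma mat_map_image_subset:
  assumes "\<And>j i. j < n \<Longrightarrow> i < p \<Longrightarrow> homogeneous (e j) (A j i)" and "\<And>j. j < n \<Longrightarrow> e j \<le> q"
  shows "mat_map n p A ` tuples n (\<lambda>j. q - e j) \<subseteq> tuples p (\<lambda>_. q)"
proof clarify
  fix h assume h: "h \<in> tuples n (\<lambda>j. q - e j)"
  have "homogeneous q (h j * A j i)" if "j < n" "i < p" for i j
    using homogeneous_mult[of "q - e j" "h j" "e j" "A j i"] h assms that by (auto simp: tuples_def)
  then show "mat_map n p A h \<in> tuples p (\<lambda>_. q)"
    by (auto simp: tuples_def mat_map_def intro!: homogeneous_sum)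
qed

text \<open>Comparing components of degree \<open>q\<close>, each coefficient \<open>g j\<close> may
  be replaced by its component of degree \<open>q - e j\<close>.\<close>

lemma mat_map_image_graded:
  assumes "\<And>j i. j < n \<Longrightarrow> i < p \<Longrightarrow> homogeneous (e j) (A j i)" and "\<And>j. j < n \<Longrightarrow> e j \<le> q"
    and h: "h \<in> tuples p (\<lambda>_. q)" and g: "\<And>i. i < p \<Longrightarrow> h i = (\<Sum>j<n. g j * A j i)"
  shows "h \<in> mat_map n p A ` tuples n (\<lambda>j. q - e j)"
proof (rule image_eqI)
  let ?g = "\<lambda>j. if j < n then hom_part (q - e j) (g j) else 0"
  show "?g \<in> tuples n (\<lambda>j. q - e j)" by (simp add: tuples_def)
  show "h = mat_map n p A ?g"
  proof
    fix i
    show "h i = mat_map n p A ?g i"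
    proof (cases "i < p")
      case True
      have "h i = hom_part q (h i)" using h True by (simp add: tuples_def homogeneous_iff_hom_part)
      also have "\<dots> = (\<Sum>j<n. hom_part q (g j * A j i))" by (simp add: g[OF True] hom_part_sum)
      also have "\<dots> = (\<Sum>j<n. ?g j * A j i)"
      proof (rule sum.cong[OF refl])
        fix j assume "j \<in> {..<n}"
        then show "hom_part q (g j * A j i) = ?g j * A j i"
          using hom_part_mult_homogeneous[OF assms(1)[of j i], of q "g j"] assms(2)[of j] True by simp
      qed
      finally show ?thesis using True by (simp add: mat_map_def)
    qed (use h in \<open>simp add: tuples_def mat_map_def\<close>)
  qed
qed

lemma jacobian_graded:
  assumes "homogeneous d f" and "d - 1 \<le> k"
  shows "jacobian_ideal f \<inter> {p. homogeneous k p}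
    = (\<lambda>h. \<Sum>j<3. h j * gradient f j) ` tuples 3 (\<lambda>_. k - (d - 1))" (is "?L = ?\<phi> ` ?T")
proof
  show "?\<phi> ` ?T \<subseteq> ?L"
  proof clarify
    fix h assume "h \<in> ?T"
    then have "homogeneous k (h j * gradient f j)" if "j < 3" for j
      using homogeneous_mult[of "k - (d-1)" "h j" "d - 1" "gradient f j"] homogeneous_gradient[OF assms(1)] assms(2) that
      by (auto simp: tuples_def)
    then have "homogeneous k (?\<phi> h)" by (intro homogeneous_sum) auto
    then show "?\<phi> h \<in> ?L" by (auto simp: jacobian_ideal_eq)
  qed
  show "?L \<subseteq> ?\<phi> ` ?T"
  proof clarify
    fix p assume "p \<in> jacobian_ideal f" and p: "homogeneous k p"
    then obtain h where h: "p = ?\<phi> h" by (auto simp: jacobian_ideal_eq)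
    let ?h = "\<lambda>j. if j < 3 then hom_part (k - (d-1)) (h j) else 0"
    have "p = hom_part k p" using p by (simp add: homogeneous_iff_hom_part)
    also have "\<dots> = ?\<phi> ?h" unfolding h hom_part_sum
      by (rule sum.cong) (use assms in \<open>auto simp: hom_part_mult_homogeneous[OF homogeneous_gradient]\<close>)
    finally have "p = ?\<phi> ?h" .
    moreover have "?h \<in> ?T" by (simp add: tuples_def)
    ultimately show "p \<in> ?\<phi> ` ?T" by (rule image_eqI)
  qed
qed

section \<open>The resolution in a fixed degree\<close>

interpretation PP: vector_space_pair smul smul ..
interpretation PT: vector_space_pair smul tscale ..

lemma (in vector_space_pair) has_dim_image_le:
  assumes "Vector_Spaces.linear s1 s2 f" "vs1.has_dim V n"
  shows "\<exists>a\<le>n. vs2.has_dim (f ` V) a"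
  using rank_nullity[OF assms] le_add1 by blast

text \<open>The number \<open>n\<close> of second syzygies is left free; \<open>m = n + 2\<close>
  enters only when the quadratic terms of the dimension count have to cancel.\<close>

locale resolution =
  fixes f :: cpoly and d r m n :: nat and \<rho> :: "nat \<Rightarrow> vec3" and \<sigma> :: "nat \<Rightarrow> nat \<Rightarrow> cpoly"
    and e :: "nat \<Rightarrow> nat"
  assumes hom: "homogeneous d f" and gen: "generates (D0 f) m \<rho>"
    and vhom: "\<And>j. j < m \<Longrightarrow> vhomogeneous r (\<rho> j)" and rel: "gen_relations m \<rho> n \<sigma> e"
begin

definition "R j i = comp i (\<rho> j)"

text \<open>The degree \<open>t\<close> part of \<open>D0 f\<close>, written as sequences;
  \<open>Rel q\<close> below plays the same role for \<open>relations\<close>.\<close>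

definition "D t = {h \<in> tuples 3 (\<lambda>_. t). (\<Sum>j<3. h j * gradient f j) = 0}"

definition "Rel q = {h \<in> tuples m (\<lambda>_. q). mat_map m 3 R h = 0}"

text \<open>Relations among the \<open>\<sigma> i\<close>, graded so that every product
  \<open>g i * \<sigma> i j\<close> has degree \<open>q\<close>. As \<open>q - e i\<close>
  truncates, this is meant for \<open>q\<close> at least every \<open>e i\<close>.\<close>

definition "K q = {g \<in> tuples n (\<lambda>i. q - e i). mat_map n m \<sigma> g = 0}"

lemma homogeneous_R: "j < m \<Longrightarrow> homogeneous r (R j i)"
  using vhom by (auto simp: R_def vhomogeneous_iff)

lemma R_gradient: "j < m \<Longrightarrow> (\<Sum>i<3. R j i * gradient f i) = 0"
  using gen unfolding R_def generates_def D0_iff by blast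

lemma relations_iff: "h \<in> relations m \<rho> \<longleftrightarrow> mat_map m 3 R h = 0"
  by (simp add: relations_def vec3_eq_iff comp_vsum comp_vscale comp_0 mat_map_def fun_eq_iff R_def)

text \<open>Exactness at \<open>D0 f\<close> in degree \<open>t\<close>: the \<open>\<rho> j\<close>
  generate and have degree \<open>r\<close>, so coefficients can be taken of degree
  \<open>t - r\<close>.\<close>

lemma image_R:
  assumes "r \<le> t"
  shows "mat_map m 3 R ` tuples m (\<lambda>_. t - r) = D t"
proof
  show "mat_map m 3 R ` tuples m (\<lambda>_. t - r) \<subseteq> D t"
  proof
    fix h assume h: "h \<in> mat_map m 3 R ` tuples m (\<lambda>_. t - r)"
    then obtain g where g: "h = mat_map m 3 R g" by blast
    have "(\<Sum>i<3. h i * gradient f i) = (\<Sum>i<3. \<Sum>j<m. g j * (R j i * gradient f i))"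
      by (simp add: g mat_map_def sum_distrib_right mult.assoc)
    also have "\<dots> = (\<Sum>j<m. g j * (\<Sum>i<3. R j i * gradient f i))"
      by (subst sum.swap) (simp add: sum_distrib_left)
    also have "\<dots> = 0" by (simp add: R_gradient)
    finally show "h \<in> D t"
      using h mat_map_image_subset[of m 3 "\<lambda>_. r" R t] homogeneous_R assms by (auto simp: D_def)
  qed
  show "D t \<subseteq> mat_map m 3 R ` tuples m (\<lambda>_. t - r)"
  proof
    fix h assume h: "h \<in> D t"
    have "(h 0, h 1, h 2) \<in> D0 f" using h unfolding D0_iff by (simp add: D_def sum_3 comp_def)
    then obtain g where g: "(h 0, h 1, h 2) = vsum (\<lambda>j. vscale (g j) (\<rho> j)) m"
      using gen by (auto simp: generates_def)
    have "comp i (h 0, h 1, h 2) = h i" if "i < 3" for i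
      using that by (auto simp: comp_def less_Suc_eq numeral_3_eq_3 numeral_2_eq_2)
    then have hi: "h i = (\<Sum>j<m. g j * R j i)" if "i < 3" for i
      using that g by (metis (no_types, lifting) R_def comp_vscale comp_vsum sum.cong)
    show "h \<in> mat_map m 3 R ` tuples m (\<lambda>_. t - r)"
      by (rule mat_map_image_graded[where g = g]) (use homogeneous_R assms h hi in \<open>auto simp: D_def\<close>)
  qed
qed

lemma homogeneous_\<sigma>: "i < n \<Longrightarrow> j < m \<Longrightarrow> homogeneous (e i) (\<sigma> i j)"
  using rel by (auto simp: gen_relations_def)

lemma \<sigma>_R: "i < n \<Longrightarrow> k < 3 \<Longrightarrow> (\<Sum>j<m. \<sigma> i j * R j k) = 0"
  using rel unfolding gen_relations_def relations_iff mat_map_def fun_eq_iff by auto metis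

text \<open>Exactness one step further left, by the same degree comparison.\<close>

lemma image_\<sigma>:
  assumes e: "\<And>i. i < n \<Longrightarrow> e i \<le> q"
  shows "mat_map n m \<sigma> ` tuples n (\<lambda>i. q - e i) = Rel q"
proof
  show "mat_map n m \<sigma> ` tuples n (\<lambda>i. q - e i) \<subseteq> Rel q"
  proof
    fix h assume h: "h \<in> mat_map n m \<sigma> ` tuples n (\<lambda>i. q - e i)"
    then obtain g where g: "h = mat_map n m \<sigma> g" by blast
    have "(\<Sum>j<m. h j * R j k) = 0" if "k < 3" for k
    proof -
      have "(\<Sum>j<m. h j * R j k) = (\<Sum>j<m. \<Sum>i<n. g i * (\<sigma> i j * R j k))"
        by (simp add: g mat_map_def sum_distrib_right mult.assoc)
      also have "\<dots> = (\<Sum>i<n. g i * (\<Sum>j<m. \<sigma> i j * R j k))"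
        by (subst sum.swap) (simp add: sum_distrib_left)
      finally show ?thesis using that by (simp add: \<sigma>_R)
    qed
    then have "mat_map m 3 R h = 0" by (simp add: mat_map_def fun_eq_iff)
    then show "h \<in> Rel q"
      using h mat_map_image_subset[of n m e \<sigma> q] homogeneous_\<sigma> e by (auto simp: Rel_def)
  qed
  show "Rel q \<subseteq> mat_map n m \<sigma> ` tuples n (\<lambda>i. q - e i)"
  proof
    fix h assume h: "h \<in> Rel q"
    then have "h \<in> relations m \<rho>" by (simp add: relations_iff Rel_def)
    then obtain g where g: "\<forall>j<m. h j = (\<Sum>i<n. g i * \<sigma> i j)"
      using rel unfolding gen_relations_def by blast
    show "h \<in> mat_map n m \<sigma> ` tuples n (\<lambda>i. q - e i)"
      by (rule mat_map_image_graded[where g = g]) (use homogeneous_\<sigma> e h g in \<open>auto simp: Rel_def\<close>)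
  qed
qed

text \<open>Rank-nullity for the three maps given by the gradient, the \<open>\<rho> j\<close> and
  the \<open>\<sigma> i\<close>. The numbers \<open>a\<close>, \<open>b\<close>, \<open>c\<close>,
  \<open>\<kappa>\<close> are the dimensions of the pieces of the Jacobian ideal, of
  \<open>D0 f\<close>, of \<open>relations\<close> and of \<open>K\<close>.\<close>

lemma hilbert_count:
  assumes e: "\<And>i. i < n \<Longrightarrow> e i \<le> q"
  obtains a b c \<kappa> where "quot_dim (jacobian_ideal f) (d - 1 + r + q) = form_dim (d - 1 + r + q) - a"
    "a \<le> form_dim (d - 1 + r + q)" "T.has_dim (D (r + q)) b" "T.has_dim (K q) \<kappa>"
    "a + b = 3 * form_dim (r + q)" "b + c = m * form_dim q" "c + \<kappa> = (\<Sum>i<n. form_dim (q - e i))"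
proof -
  let ?k = "d - 1 + r + q"
  have J: "jacobian_ideal f \<inter> {p. homogeneous ?k p} = (\<lambda>h. \<Sum>j<3. h j * gradient f j) ` tuples 3 (\<lambda>_. r + q)"
    using jacobian_graded[OF hom, of ?k] by (simp add: add.assoc)
  have 3: "T.has_dim (tuples 3 (\<lambda>_. r + q)) (3 * form_dim (r + q))"
    using has_dim_tuples[of 3 "\<lambda>_. r + q"] by simp
  obtain a b where ab: "P.has_dim (jacobian_ideal f \<inter> {p. homogeneous ?k p}) a"
      "T.has_dim (D (r + q)) b" "a + b = 3 * form_dim (r + q)"
    using TP.rank_nullity[OF linear_comb 3] unfolding J D_def by blast
  have "T.has_dim (tuples m (\<lambda>_. q)) (m * form_dim q)" using has_dim_tuples[of m "\<lambda>_. q"] by simp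
  from TT.rank_nullity[OF linear_mat_map[of m 3 R] this]
  obtain b' c where bc: "T.has_dim (D (r + q)) b'" "T.has_dim (Rel q) c" "b' + c = m * form_dim q"
    using image_R[of "r + q"] unfolding Rel_def by auto
  have b: "b' = b" using T.has_dim_unique bc(1) ab(2) by blast
  from TT.rank_nullity[OF linear_mat_map[of n m \<sigma>] has_dim_tuples[of n "\<lambda>i. q - e i"]]
  obtain c' \<kappa> where ck: "T.has_dim (Rel q) c'" "T.has_dim (K q) \<kappa>" "c' + \<kappa> = (\<Sum>i<n. form_dim (q - e i))"
    using image_\<sigma>[OF e] unfolding K_def by auto
  have c: "c' = c" using T.has_dim_unique bc(2) ck(1) by blast
  show thesis
    using that quot_dim_eq[OF subspace_jacobian ab(1)] ab(2,3) bc(3) ck(2,3) b c by blast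
qed

text \<open>Multiplication of \<open>g\<close> by forms of degree \<open>q - q0\<close> maps into
  \<open>K q\<close> and is injective, since there are no zero divisors.\<close>

lemma K_grows:
  assumes g: "g \<in> K q0" "g \<noteq> 0" and e: "\<And>i. i < n \<Longrightarrow> e i \<le> q0" and "q0 \<le> q"
    and \<kappa>: "T.has_dim (K q) \<kappa>"
  shows "form_dim (q - q0) \<le> \<kappa>"
proof -
  let ?\<mu> = "\<lambda>u :: cpoly. \<lambda>j. u * g j" and ?S = "{p. homogeneous (q - q0) p}"
  have lin: "Vector_Spaces.linear smul tscale ?\<mu>"
    by (simp add: Vector_Spaces.linear_iff T.vector_space_axioms P.vector_space_axioms tscale_def smul_def
      fun_eq_iff algebra_simps)
  obtain a b where ab: "T.has_dim (?\<mu> ` ?S) a" "P.has_dim {u \<in> ?S. ?\<mu> u = 0} b" "a + b = form_dim (q - q0)"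
    using PT.rank_nullity[OF lin has_dim_homogeneous] by blast
  obtain j where "g j \<noteq> 0" using g(2) by (auto simp: fun_eq_iff)
  then have "{u \<in> ?S. ?\<mu> u = 0} = {0}" by (auto simp: fun_eq_iff)
  then have "b = 0" using ab(2) P.has_dim_trivial P.has_dim_unique by metis
  moreover have "?\<mu> ` ?S \<subseteq> K q"
  proof clarify
    fix u assume u: "homogeneous (q - q0) u"
    have "homogeneous (q - e i) (u * g i)" if "i < n" for i
      using homogeneous_mult[OF u, of "q0 - e i" "g i"] g(1) that e[OF that] \<open>q0 \<le> q\<close>
      by (auto simp: K_def tuples_def)
    moreover have "mat_map n m \<sigma> (?\<mu> u) = (\<lambda>i. u * mat_map n m \<sigma> g i)"
      by (auto simp: mat_map_def fun_eq_iff sum_distrib_left mult.assoc)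
    ultimately show "?\<mu> u \<in> K q" using g(1) by (auto simp: K_def tuples_def)
  qed
  ultimately show ?thesis using T.has_dim_mono[OF \<kappa> ab(1)] ab(3) by simp
qed

text \<open>The two summands bound the third entries and the syzygies with third entry zero;
  \<open>\<eta>\<close> is the degree of \<open>h\<close>, a greatest common divisor of
  \<open>dx f\<close> and \<open>dy f\<close>.\<close>

lemma D_bound:
  assumes red: "reduced f" and "d \<ge> 1" and nz: "dx f \<noteq> 0" "dy f \<noteq> 0" "dz f \<noteq> 0"
  shows "\<exists>\<eta>\<le>d - 1. \<forall>t\<ge>d - 1. \<forall>b. T.has_dim (D t) b \<longrightarrow> b \<le> form_dim (t - \<eta>) + form_dim (t - (d - 1 - \<eta>))"
proof -
  let ?s = "d - 1"
  obtain h a b where h: "dx f = h * a" "dy f = h * b" and cop: "\<And>u v. a * u = b * v \<Longrightarrow> a dvd v"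
    using cpoly_gcd[OF nz(1,2)] by blast
  have nz': "h \<noteq> 0" "a \<noteq> 0" "b \<noteq> 0" using h nz by auto
  obtain h' a' b' where h': "h = h' * a'" "dz f = h' * b'" and cop': "\<And>u v. a' * u = b' * v \<Longrightarrow> a' dvd v"
    using cpoly_gcd[OF nz'(1) nz(3)] by blast
  \<comment> \<open>A prime factor of \<open>h'\<close> would divide all three partial
    derivatives.\<close>
  have "h' dvd 1"
  proof (rule ccontr)
    assume "\<not> h' dvd 1"
    moreover have "h' \<noteq> 0" using h' nz by auto
    ultimately obtain g where "prime_elem g" "g dvd h'" using cpoly_prime_divisor by blast
    then show False
      using reduced_no_common_prime[OF red hom \<open>d \<ge> 1\<close>, of g] by (simp add: h h' dvd_mult2)
  qed
  then obtain w where w: "1 = h' * w" by blast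
  \<comment> \<open>As \<open>h'\<close> is a unit, \<open>h\<close> itself inherits Euclid's lemma
    from \<open>a'\<close>.\<close>
  have cop_h: "h dvd v" if "h * u = dz f * v" for u v
  proof -
    have "h' * (a' * u - b' * v) = 0" using that h' by (simp add: algebra_simps)
    then have "a' * u = b' * v" using nz'(1) h'(1) by simp
    then have "a' dvd v" by (rule cop')
    then have "h' * a' dvd h' * w * v" by (simp add: mult.assoc mult_dvd_mono)
    then show ?thesis using w h' by simp
  qed
  obtain \<eta> where \<eta>: "homogeneous \<eta> h" using homogeneous_factor[of ?s h a] homogeneous_dx[OF hom] h nz by auto
  obtain \<alpha> where \<alpha>: "homogeneous \<alpha> a"
    using homogeneous_factor[of ?s a h] homogeneous_dx[OF hom] h nz by (auto simp: mult.commute)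
  obtain \<beta> where \<beta>: "homogeneous \<beta> b"
    using homogeneous_factor[of ?s b h] homogeneous_dy[OF hom] h nz by (auto simp: mult.commute)
  have "\<eta> + \<alpha> = ?s" "\<eta> + \<beta> = ?s"
    using homogeneous_unique[OF homogeneous_mult[OF \<eta> \<alpha>]] homogeneous_unique[OF homogeneous_mult[OF \<eta> \<beta>]]
      homogeneous_dx[OF hom] homogeneous_dy[OF hom] h nz by auto
  then have deg: "\<eta> \<le> ?s" "\<alpha> = ?s - \<eta>" "\<beta> = ?s - \<eta>" by auto
  have "c \<le> form_dim (t - \<eta>) + form_dim (t - (?s - \<eta>))" if t: "?s \<le> t" and c: "T.has_dim (D t) c" for t c
  proof -
    obtain a1 b1 where ab: "P.has_dim ((\<lambda>x. x 2) ` D t) a1" "T.has_dim {x \<in> D t. x 2 = 0} b1" "a1 + b1 = c"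
      using TP.rank_nullity[OF linear_component c] by blast
    have eq: "h * (a * x 0 + b * x 1) = dz f * - x 2" if "x \<in> D t" for x
      using that h by (simp add: D_def sum_3 gradient_def comp_def algebra_simps eq_neg_iff_add_eq_0)
    have lin1: "Vector_Spaces.linear smul smul (\<lambda>u. u * h)"
      by (simp add: Vector_Spaces.linear_iff P.vector_space_axioms smul_def algebra_simps)
    have "(\<lambda>x. x 2) ` D t \<subseteq> (\<lambda>u. u * h) ` {p. homogeneous (t - \<eta>) p}"
    proof clarify
      fix x assume x: "x \<in> D t"
      have "h dvd x 2" using cop_h[OF eq[OF x]] by simp
      then obtain u where u: "x 2 = u * h" by (metis dvdE mult.commute)
      have "x 2 = hom_part t (x 2)" using x by (simp add: D_def tuples_def homogeneous_iff_hom_part)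
      also have "\<dots> = hom_part (t - \<eta>) u * h" using hom_part_mult_homogeneous[OF \<eta>] u deg t by simp
      finally show "x 2 \<in> (\<lambda>u. u * h) ` {p. homogeneous (t - \<eta>) p}" by simp
    qed
    then have a1: "a1 \<le> form_dim (t - \<eta>)"
      using PP.has_dim_image_le[OF lin1 has_dim_homogeneous] P.has_dim_mono ab(1) by (meson le_trans)
    \<comment> \<open>The multiples of \<open>(b, -a, 0)\<close>, as sequences.\<close>
    let ?\<nu> = "\<lambda>w. \<lambda>j :: nat. if j = 0 then w * b else if j = 1 then - (w * a) else 0"
    have lin2: "Vector_Spaces.linear smul tscale ?\<nu>"
      by (auto simp: Vector_Spaces.linear_iff P.vector_space_axioms T.vector_space_axioms
         smul_def tscale_def fun_eq_iff algebra_simps)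
    have "{x \<in> D t. x 2 = 0} \<subseteq> ?\<nu> ` {p. homogeneous (t - (?s - \<eta>)) p}"
    proof clarify
      fix x assume x: "x \<in> D t" "x 2 = 0"
      have "h * (a * x 0 + b * x 1) = 0" using eq[OF x(1)] x(2) by simp
      then have "a * x 0 + b * x 1 = 0" using nz'(1) by (simp only: cpoly_mult_eq_0_iff) simp
      then have *: "a * x 0 = b * - x 1" by (simp add: eq_neg_iff_add_eq_0)
      then have "a dvd - x 1" by (rule cop)
      then obtain w where w: "x 1 = - (w * a)" by (metis dvdE mult.commute minus_minus)
      let ?w = "hom_part (t - (?s - \<eta>)) w"
      have tup: "homogeneous t (x 1)" "\<And>j. j \<ge> 3 \<Longrightarrow> x j = 0" using x by (auto simp: D_def tuples_def)
      have "x 1 = hom_part t (x 1)" using tup(1) by (simp add: homogeneous_iff_hom_part)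
      also have "\<dots> = - (?w * a)" using hom_part_mult_homogeneous[OF \<alpha>] w deg t by (simp add: hom_part_uminus)
      finally have x1: "x 1 = - (?w * a)" .
      have "a * (x 0 - ?w * b) = 0" using * unfolding x1 by (simp add: algebra_simps)
      then have x0: "x 0 = ?w * b" using nz'(2) by simp
      have "x j = ?\<nu> ?w j" for j
      proof -
        consider "j = 0" | "j = 1" | "j = 2" | "j \<ge> 3" by linarith
        then show ?thesis using x0 x1 x(2) tup(2) by cases auto
      qed
      then have "x = ?\<nu> ?w" by (rule ext)
      then show "x \<in> ?\<nu> ` {p. homogeneous (t - (?s - \<eta>)) p}" by (rule image_eqI) simp
    qed
    then have "b1 \<le> form_dim (t - (?s - \<eta>))"
      using PT.has_dim_image_le[OF lin2 has_dim_homogeneous] T.has_dim_mono ab(2) by (meson le_trans)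
    then show ?thesis using a1 ab(3) by simp
  qed
  then show ?thesis using deg(1) by blast
qed

end

subsection \<open>The Hilbert polynomial\<close>

lemma quadratic_not_le_linear:
  fixes L M :: int
  assumes "\<And>x :: nat. x \<ge> x0 \<Longrightarrow> (int x + 1) * (int x + 2) \<le> L * int x + M"
  shows False
proof -
  \<comment> \<open>Large enough that \<open>L * x\<close> is at most the square of \<open>x\<close>
    and \<open>M\<close> at most \<open>x\<close>.\<close>
  define x where "x = x0 + nat \<bar>L\<bar> + nat \<bar>M\<bar>"
  have x: "int x \<ge> \<bar>L\<bar>" "int x \<ge> \<bar>M\<bar>" by (auto simp: x_def)
  have "L * int x \<le> int x * int x" using x(1) by (intro mult_right_mono) auto
  moreover have "(int x + 1) * (int x + 2) = int x * int x + 3 * int x + 2" by (simp add: algebra_simps)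
  moreover have "x \<ge> x0" by (simp add: x_def)
  ultimately show False using assms[of x] x(2) by linarith
qed

lemma linear_nonneg_slope:
  fixes L M :: int
  assumes "\<And>x :: nat. x \<ge> x0 \<Longrightarrow> 0 \<le> L * int x + M"
  shows "0 \<le> L"
proof (rule ccontr)
  assume "\<not> 0 \<le> L"
  define x where "x = x0 + nat \<bar>M\<bar> + 1"
  have "L * int x \<le> - int x" using \<open>\<not> 0 \<le> L\<close> mult_right_mono[of L "-1" "int x"] by simp
  moreover have "x \<ge> x0" "int x > \<bar>M\<bar>" by (auto simp: x_def)
  ultimately show False using assms[of x] by linarith
qed

lemma int_form_dim: "2 * int (form_dim k) = (int k + 1) * (int k + 2)"
proof -
  have "int (2 * form_dim k) = int ((k + 1) * (k + 2))" by (simp only: form_dim_double)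
  then show ?thesis by (simp add: algebra_simps)
qed

context resolution
begin

text \<open>Otherwise a unit vector would be a syzygy of degree 0, although all generators have degree \<open>r\<close>.\<close>

lemma gradient_nonzero:
  assumes "r \<ge> 1" "i < 3"
  shows "gradient f i \<noteq> 0"
proof
  assume 0: "gradient f i = 0"
  define v :: vec3 where "v = (if i = 0 then 1 else 0, if i = 1 then 1 else 0, if i = 2 then 1 else 0)"
  have "i = 0 \<or> i = 1 \<or> i = 2" using assms(2) by linarith
  then have v: "comp i v = 1" and "v \<in> D0 f"
    using 0 unfolding D0_iff by (auto simp: v_def comp_def sum_3)
  then obtain g where "v = vsum (\<lambda>j. vscale (g j) (\<rho> j)) m"
    using gen unfolding generates_def by blast
  then have "1 = (\<Sum>j<m. g j * R j i)" using v by (simp add: comp_vsum comp_vscale R_def)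
  \<comment> \<open>In degree 0 the right-hand side vanishes, because every \<open>R j i\<close> has
    degree \<open>r \<ge> 1\<close>.\<close>
  then have "hom_part 0 1 = (\<Sum>j<m. hom_part 0 (g j * R j i))" by (simp flip: hom_part_sum)
  also have "\<dots> = 0" using hom_part_mult_homogeneous[OF homogeneous_R] assms(1) by simp
  finally have "hom_part 0 1 = 0" .
  moreover have "hom_part 0 1 = 1" using hom_part_homogeneous[OF homogeneous_const, of 0 1] by simp
  ultimately show False by simp
qed

text \<open>The entry \<open>\<sigma> i j0\<close> is a nonzero constant, so the relation can be
  solved for \<open>\<rho> j0\<close>; \<open>b\<close> enumerates the remaining generators.
  Minimality will thus force \<open>e i\<close> to be positive.\<close>

lemma constant_relation_drops_generator:
  assumes i: "i < n" "e i = 0" and j0: "j0 < m" "\<sigma> i j0 \<noteq> 0"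
  shows "\<exists>b. (\<forall>j<m - 1. b j < m) \<and> generates (D0 f) (m - 1) (\<rho> \<circ> b)"
proof -
  obtain c where c: "\<sigma> i j0 = const c"
    using homogeneous_0D homogeneous_\<sigma>[OF i(1) j0(1)] i(2) by metis
  then have "c \<noteq> 0" using j0(2) by auto
  obtain b where b: "bij_betw b {..<m - 1} ({..<m} - {j0})"
    using ex_bij_betw_nat_finite[of "{..<m} - {j0}"] j0(1) by (auto simp: atLeast0LessThan)
  have bm: "b j < m" if "j < m - 1" for j using bij_betwE[OF b] that by auto
  have "generates (D0 f) (m - 1) (\<rho> \<circ> b)"
    unfolding generates_def
  proof (intro conjI allI impI ballI)
    show "(\<rho> \<circ> b) j \<in> D0 f" if "j < m - 1" for j
      using gen bm[OF that] by (simp add: generates_def)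
    fix v assume "v \<in> D0 f"
    then obtain g where g: "v = vsum (\<lambda>j. vscale (g j) (\<rho> j)) m"
      using gen unfolding generates_def by blast
    \<comment> \<open>Subtracting this multiple of the relation leaves the combination unchanged and
      makes the coefficient at \<open>j0\<close> zero.\<close>
    define g' where "g' j = g j - const (1 / c) * g j0 * \<sigma> i j" for j
    have "const (1 / c) * const c = 1" using \<open>c \<noteq> 0\<close> by (simp add: const_mult[symmetric])
    moreover have "const (1 / c) * g j0 * const c = (const (1 / c) * const c) * g j0"
      by (simp only: mult_ac)
    ultimately have "g' j0 = 0" by (simp add: g'_def c)
    have "comp k v = comp k (vsum (\<lambda>j. vscale (g' (b j)) ((\<rho> \<circ> b) j)) (m - 1))" if "k < 3" for k
    proof -
      have "comp k v = (\<Sum>j<m. g j * R j k)" by (simp add: g comp_vsum comp_vscale R_def)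
      also have "\<dots> = (\<Sum>j<m. g' j * R j k) + const (1 / c) * g j0 * (\<Sum>j<m. \<sigma> i j * R j k)"
        by (simp add: g'_def sum_distrib_left sum_subtractf algebra_simps)
      also have "\<dots> = (\<Sum>j<m. g' j * R j k)" using \<sigma>_R[OF i(1) that] by simp
      also have "\<dots> = (\<Sum>j\<in>{..<m} - {j0}. g' j * R j k)"
        using \<open>g' j0 = 0\<close> j0(1) by (simp add: sum.remove[of _ j0])
      also have "\<dots> = (\<Sum>j<m - 1. g' (b j) * R (b j) k)"
        by (rule sum.reindex_bij_betw[OF b, symmetric])
      finally show ?thesis by (simp add: comp_vsum comp_vscale R_def)
    qed
    then have "v = vsum (\<lambda>j. vscale (g' (b j)) ((\<rho> \<circ> b) j)) (m - 1)" unfolding vec3_eq_iff by blast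
    then show "\<exists>h. v = vsum (\<lambda>j. vscale (h j) ((\<rho> \<circ> b) j)) (m - 1)"
      by (rule exI[of _ "\<lambda>j. g' (b j)"])
  qed
  then show ?thesis using bm by blast
qed

text \<open>The last two conclusions read off the linear and the constant coefficient of the
  dimension count. The first supplies the nonzero entry that
  \<open>constant_relation_drops_generator\<close> asks for.\<close>

lemma degrees_and_tjurina:
  assumes red: "reduced f" and "d \<ge> 1" "r \<ge> 1" and n: "m = n + 2"
  defines "s \<equiv> int d - 1" and "S2 \<equiv> \<Sum>i<n. (int (e i))\<^sup>2"
  shows "\<And>i. i < n \<Longrightarrow> \<exists>j<m. \<sigma> i j \<noteq> 0"
    and "(\<Sum>i<n. int (e i)) = 2 * int r - s"
    and "2 * int (tjurina f) = s\<^sup>2 + 2 * int r * s - 2 * (int r)\<^sup>2 - S2"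
proof -
  define S1 where "S1 = (\<Sum>i<n. int (e i))"
  \<comment> \<open>From \<open>Q\<close> on, no subtraction of an \<open>e i\<close>, of
    \<open>\<eta>\<close> or of \<open>d - 1 - \<eta>\<close> truncates.\<close>
  define Q where "Q = d + (\<Sum>i<n. e i)"
  have eQ: "e i \<le> Q" if "i < n" for i
    using member_le_sum[of i "{..<n}" e] that by (simp add: Q_def)
  have nz: "dx f \<noteq> 0" "dy f \<noteq> 0" "dz f \<noteq> 0"
    using gradient_nonzero[OF \<open>r \<ge> 1\<close>, of 0] gradient_nonzero[OF \<open>r \<ge> 1\<close>, of 1] gradient_nonzero[OF \<open>r \<ge> 1\<close>, of 2]
    by (simp_all add: gradient_def comp_def)
  obtain \<eta> where \<eta>: "\<eta> \<le> d - 1"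
    and bound: "\<And>t b. t \<ge> d - 1 \<Longrightarrow> T.has_dim (D t) b \<Longrightarrow> b \<le> form_dim (t - \<eta>) + form_dim (t - (d - 1 - \<eta>))"
    using D_bound[OF red \<open>d \<ge> 1\<close> nz] by blast
  \<comment> \<open>Twice the contribution of the last two free modules; \<open>n\<close> of the
    \<open>m = n + 2\<close> quadratic terms cancel, which leaves the factor 2.\<close>
  define F where "F q = 2 * (int q ^ 2 + 3 * int q + 2) + (2 * int q + 3) * S1 - S2" for q
  have F: "2 * (int m * int (form_dim q)) - 2 * (\<Sum>i<n. int (form_dim (q - e i))) = F q" if "q \<ge> Q" for q
  proof -
    have "2 * (\<Sum>i<n. int (form_dim (q - e i))) = (\<Sum>i<n. (int q ^ 2 + 3 * int q + 2) - (2 * int q + 3) * int (e i) + int (e i) ^ 2)"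
      unfolding sum_distrib_left
    proof (rule sum.cong[OF refl])
      fix i assume "i \<in> {..<n}"
      then have "int (q - e i) = int q - int (e i)" using eQ[of i] that by (simp add: of_nat_diff)
      then show "2 * int (form_dim (q - e i)) = (int q ^ 2 + 3 * int q + 2) - (2 * int q + 3) * int (e i) + int (e i) ^ 2"
        unfolding int_form_dim by (simp add: power2_eq_square algebra_simps)
    qed
    also have "\<dots> = int n * (int q ^ 2 + 3 * int q + 2) - (2 * int q + 3) * S1 + S2"
      by (simp add: sum.distrib sum_subtractf S1_def S2_def sum_distrib_left)
    finally have 1: "2 * (\<Sum>i<n. int (form_dim (q - e i))) = int n * (int q ^ 2 + 3 * int q + 2) - (2 * int q + 3) * S1 + S2" .
    have 2: "2 * (int m * int (form_dim q)) = (int n + 2) * (int q ^ 2 + 3 * int q + 2)"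
    proof -
      have "2 * (int m * int (form_dim q)) = int m * (2 * int (form_dim q))" by simp
      then show ?thesis unfolding int_form_dim n by (simp add: power2_eq_square algebra_simps)
    qed
    show ?thesis unfolding 1 2 F_def by (simp add: algebra_simps)
  qed
  \<comment> \<open>Twice the dimensions are integer polynomials: the bound on the syzygies of the gradient gives
    \<open>2 \<kappa>(q) \<le> L q + M\<close>, and once \<open>\<kappa> = 0\<close>, twice the dimension of \<open>M(f)\<^sub>k\<close> is \<open>- L q - M'\<close>.\<close>
  define L where "L = 4 * int r - 2 * s - 2 * S1"
  define M where "M = 2 * int r ^ 2 + 6 * int r - s * (2 * int r + 3) + int \<eta> ^ 2 + (s - int \<eta>) ^ 2 - 3 * S1 + S2"
  define M' where "M' = 2 * int r ^ 2 + 6 * int r - s * (2 * int r + 3) - s ^ 2 - 3 * S1 + S2"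
  have count: "\<exists>a b \<kappa>. quot_dim (jacobian_ideal f) (d - 1 + r + q) = form_dim (d - 1 + r + q) - a
     \<and> a \<le> form_dim (d - 1 + r + q) \<and> T.has_dim (K q) \<kappa> \<and> a + b = 3 * form_dim (r + q)
     \<and> 2 * int b = F q + 2 * int \<kappa> \<and> 2 * int \<kappa> \<le> L * int q + M" if q: "q \<ge> Q" for q
  proof -
    have eq: "e i \<le> q" if "i < n" for i using eQ[OF that] q by linarith
    obtain a b c \<kappa> where *: "quot_dim (jacobian_ideal f) (d - 1 + r + q) = form_dim (d - 1 + r + q) - a"
      "a \<le> form_dim (d - 1 + r + q)" "T.has_dim (D (r + q)) b" "T.has_dim (K q) \<kappa>"
      "a + b = 3 * form_dim (r + q)" "b + c = m * form_dim q" "c + \<kappa> = (\<Sum>i<n. form_dim (q - e i))"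
      by (rule hilbert_count[OF eq])
    have "int b + int c = int m * int (form_dim q)" using arg_cong[OF *(6), of int] by simp
    moreover have "int c + int \<kappa> = (\<Sum>i<n. int (form_dim (q - e i)))" using arg_cong[OF *(7), of int] by simp
    ultimately have b: "2 * int b = F q + 2 * int \<kappa>" using F[OF q] by linarith
    have rq: "r + q \<ge> d - 1" using q by (simp add: Q_def)
    have i1: "int (r + q - \<eta>) = int r + int q - int \<eta>" using \<eta> rq by (simp add: of_nat_diff)
    have i2: "int (r + q - (d - 1 - \<eta>)) = int r + int q - s + int \<eta>"
      using \<eta> rq \<open>d \<ge> 1\<close> by (simp add: of_nat_diff s_def)
    have "int b \<le> int (form_dim (r + q - \<eta>)) + int (form_dim (r + q - (d - 1 - \<eta>)))"
      using bound[OF rq *(3)] by linarith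
    then have "2 * int b \<le> (int r + int q - int \<eta> + 1) * (int r + int q - int \<eta> + 2)
        + (int r + int q - s + int \<eta> + 1) * (int r + int q - s + int \<eta> + 2)"
      using int_form_dim[of "r + q - \<eta>"] int_form_dim[of "r + q - (d - 1 - \<eta>)"] unfolding i1 i2 by linarith
    \<comment> \<open>Both sides have leading term twice the square of \<open>q\<close>, so only a
      linear bound on \<open>\<kappa>\<close> remains.\<close>
    also have "\<dots> = F q + (L * int q + M)"
      unfolding F_def L_def M_def by (simp add: power2_eq_square algebra_simps)
    finally show ?thesis using *(1,2,4,5) b by (intro exI[of _ a] exI[of _ b] exI[of _ \<kappa>]) auto
  qed
  have K0: "g = 0" if g: "g \<in> K q0" "q0 \<ge> Q" for g q0
  proof (rule ccontr)
    assume "g \<noteq> 0"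
    have "(int x + 1) * (int x + 2) \<le> L * int x + (L * int q0 + M)" for x
    proof -
      obtain \<kappa> where \<kappa>: "T.has_dim (K (q0 + x)) \<kappa>" "2 * int \<kappa> \<le> L * int (q0 + x) + M"
        using count[of "q0 + x"] g(2) trans_le_add1 by blast
      have "e i \<le> q0" if "i < n" for i using eQ[OF that] g(2) by linarith
      from K_grows[OF g(1) \<open>g \<noteq> 0\<close> this _ \<kappa>(1)] have "form_dim x \<le> \<kappa>" by simp
      then have "2 * int (form_dim x) \<le> L * int (q0 + x) + M" using \<kappa>(2) by linarith
      then show ?thesis unfolding int_form_dim by (simp add: algebra_simps)
    qed
    then show False using quadratic_not_le_linear[of 0 L "L * int q0 + M"] by blast
  qed
  show "\<exists>j<m. \<sigma> i j \<noteq> 0" if "i < n" for i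
  proof (rule ccontr)
    assume 0: "\<not> (\<exists>j<m. \<sigma> i j \<noteq> 0)"
    \<comment> \<open>If \<open>\<sigma> i\<close> vanished, a power of x in position
      \<open>i\<close> would be a nonzero element of \<open>K Q\<close>.\<close>
    let ?g = "\<lambda>k. if k = i then Poly_Mapping.single (Q - e i, 0, 0) 1 else (0 :: cpoly)"
    have "mdeg (Q - e i, 0, 0) = Q - e i" by (simp add: mdeg_def)
    then have "?g \<in> tuples n (\<lambda>i. Q - e i)"
      using that homogeneous_single[of "(Q - e i, 0, 0)" 1] by (auto simp: tuples_def)
    moreover have "mat_map n m \<sigma> ?g = 0"
      using 0 by (auto simp: mat_map_def fun_eq_iff intro!: sum.neutral)
    ultimately have "?g = 0" using K0[of ?g Q] by (simp add: K_def)
    then have "Poly_Mapping.single (Q - e i, 0, 0) 1 = (0 :: cpoly)" by (drule_tac fun_cong[of _ _ i]) simp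
    then show False by (metis lookup_single_eq lookup_zero zero_neq_one)
  qed
  have count0: "\<exists>a. quot_dim (jacobian_ideal f) (d - 1 + r + q) = form_dim (d - 1 + r + q) - a
     \<and> a \<le> form_dim (d - 1 + r + q) \<and> 2 * int a = 6 * int (form_dim (r + q)) - F q \<and> 0 \<le> L * int q + M"
    if q: "q \<ge> Q" for q
  proof -
    obtain a b \<kappa> where *: "quot_dim (jacobian_ideal f) (d - 1 + r + q) = form_dim (d - 1 + r + q) - a"
      "a \<le> form_dim (d - 1 + r + q)" "T.has_dim (K q) \<kappa>" "a + b = 3 * form_dim (r + q)"
      "2 * int b = F q + 2 * int \<kappa>" "2 * int \<kappa> \<le> L * int q + M"
      using count[OF q] by blast
    have "K q \<subseteq> {0}" using K0 q by blast
    then have "\<kappa> = 0" using T.has_dim_mono[OF T.has_dim_trivial *(3)] by simp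
    moreover have "int a + int b = 3 * int (form_dim (r + q))" using arg_cong[OF *(4), of int] by simp
    ultimately show ?thesis using * by (intro exI[of _ a]) auto
  qed
  have sk: "2 * int (form_dim (d - 1 + r + q)) - 6 * int (form_dim (r + q)) + F q = - L * int q - M'" for q
  proof -
    have "int (d - 1 + r + q) = s + int r + int q" using \<open>d \<ge> 1\<close> by (simp add: s_def of_nat_diff)
    then have "2 * int (form_dim (d - 1 + r + q)) = (s + int r + int q + 1) * (s + int r + int q + 2)"
      by (simp add: int_form_dim)
    moreover have "6 * int (form_dim (r + q)) = 3 * ((int r + int q + 1) * (int r + int q + 2))"
      using int_form_dim[of "r + q"] by simp
    ultimately show ?thesis unfolding F_def L_def M'_def by (simp add: power2_eq_square algebra_simps)
  qed
  \<comment> \<open>The bound on syzygies keeps \<open>L * q + M\<close> nonnegative, and dimensions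
    of the quotient keep \<open>- L * q - M'\<close> nonnegative; together they give
    \<open>L = 0\<close>.\<close>
  have "0 \<le> L" using linear_nonneg_slope[of Q L M] count0 by blast
  moreover have "0 \<le> - L"
  proof (rule linear_nonneg_slope[of Q "- L" "- M'"])
    fix q assume "q \<ge> Q"
    then obtain a where "a \<le> form_dim (d - 1 + r + q)" "2 * int a = 6 * int (form_dim (r + q)) - F q"
      using count0 by blast
    then show "0 \<le> - L * int q + - M'" using sk[of q] by linarith
  qed
  ultimately have L0: "L = 0" by simp
  then have S1: "S1 = 2 * int r - s" by (simp add: L_def)
  then show "(\<Sum>i<n. int (e i)) = 2 * int r - s" by (simp add: S1_def)
  have quot: "2 * int (quot_dim (jacobian_ideal f) (d - 1 + r + q)) = - M'" if q: "q \<ge> Q" for q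
  proof -
    obtain a where "quot_dim (jacobian_ideal f) (d - 1 + r + q) = form_dim (d - 1 + r + q) - a"
       "a \<le> form_dim (d - 1 + r + q)" "2 * int a = 6 * int (form_dim (r + q)) - F q"
      using count0[OF q] by blast
    then show ?thesis using sk[of q] L0 by simp
  qed
  let ?\<tau> = "quot_dim (jacobian_ideal f) (d - 1 + r + Q)"
  have "quot_dim (jacobian_ideal f) k = ?\<tau>" if k: "k \<ge> d - 1 + r + Q" for k
  proof -
    obtain x where "k = d - 1 + r + (Q + x)" using le_Suc_ex[OF k] by (auto simp: add.assoc)
    then show ?thesis using quot[of "Q + x"] quot[of Q] by simp
  qed
  then have ev: "\<forall>\<^sub>F k in sequentially. quot_dim (jacobian_ideal f) k = ?\<tau>"
    unfolding eventually_sequentially by blast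
  have "tjurina f = ?\<tau>"
    unfolding tjurina_def
  proof (rule the_equality)
    show "\<forall>\<^sub>F k in sequentially. quot_dim (jacobian_ideal f) k = ?\<tau>" by (rule ev)
    fix t assume "\<forall>\<^sub>F k in sequentially. quot_dim (jacobian_ideal f) k = t"
    then have "\<forall>\<^sub>F k :: nat in sequentially. t = ?\<tau>" using ev by eventually_elim simp
    then show "t = ?\<tau>" by simp
  qed
  then have "2 * int (tjurina f) = - M'" using quot[of Q] by simp
  then show "2 * int (tjurina f) = s\<^sup>2 + 2 * int r * s - 2 * (int r)\<^sup>2 - S2"
    unfolding M'_def S1 by (simp add: power2_eq_square algebra_simps)
qed

end

subsection \<open>The three cases\<close>

text \<open>By monotonicity, a zero at position \<open>k - 1\<close> would make all earlier entries
  zero.\<close>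

lemma last_pos_of_sum_pos:
  fixes y :: "nat \<Rightarrow> nat"
  assumes mono: "\<And>i j. i \<le> j \<Longrightarrow> j < n \<Longrightarrow> y i \<le> y j" and pos: "0 < (\<Sum>i<k. y i)" and "k \<le> n"
  shows "0 < k" "0 < y (k - 1)"
proof -
  show k: "0 < k" using pos by (cases k) auto
  show "0 < y (k - 1)"
  proof (rule ccontr)
    assume "\<not> 0 < y (k - 1)"
    then have "y i = 0" if "i < k" for i using mono[of i "k - 1"] that \<open>k \<le> n\<close> by force
    then show False using pos by simp
  qed
qed

text \<open>The partitions 3, 2+1 and 1+1+1, read from the end. The sums of squares are included
  because they determine the Tjurina number; the third partition needs a third entry, so
  \<open>n \<ge> 3\<close> is concluded there.\<close>

lemma sorted_partitions_of_3:
  fixes y :: "nat \<Rightarrow> nat"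
  assumes mono: "\<And>i j. i \<le> j \<Longrightarrow> j < n \<Longrightarrow> y i \<le> y j" and sum: "(\<Sum>i<n. y i) = 3" and "n \<ge> 2"
  shows "(y (n - 1) = 3 \<and> (\<forall>i<n - 1. y i = 0) \<and> (\<Sum>i<n. (y i)\<^sup>2) = 9) \<or>
    (y (n - 1) = 2 \<and> y (n - 2) = 1 \<and> (\<forall>i<n - 2. y i = 0) \<and> (\<Sum>i<n. (y i)\<^sup>2) = 5) \<or>
    (n \<ge> 3 \<and> y (n - 1) = 1 \<and> y (n - 2) = 1 \<and> y (n - 3) = 1 \<and> (\<forall>i<n - 3. y i = 0) \<and> (\<Sum>i<n. (y i)\<^sup>2) = 3)"
proof -
  obtain k where n: "n = Suc (Suc k)" using \<open>n \<ge> 2\<close> by (metis add_2_eq_Suc le_Suc_ex)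
  have s: "(\<Sum>i<k. y i) + y k + y (Suc k) = 3" using sum by (simp add: n)
  have sq: "(\<Sum>i<n. (y i)\<^sup>2) = (\<Sum>i<k. (y i)\<^sup>2) + (y k)\<^sup>2 + (y (Suc k))\<^sup>2" by (simp add: n)
  have zero: "(\<forall>i<l. y i = 0) \<and> (\<Sum>i<l. (y i)\<^sup>2) = 0" if "(\<Sum>i<l. y i) = 0" for l using that by simp
  have a: "y k \<le> y (Suc k)" using mono[of k "Suc k"] by (simp add: n)
  have b: "(\<Sum>i<k. y i) + y k > 0 \<Longrightarrow> y k > 0"
    using last_pos_of_sum_pos(2)[of n y "Suc k", OF mono] n by simp
  have c: "y k = 1 \<Longrightarrow> (\<Sum>i<k. y i) > 0 \<Longrightarrow> k > 0 \<and> y (k - 1) = 1"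
    using last_pos_of_sum_pos[of n y k, OF mono] mono[of "k - 1" k] n by simp
  consider "y (Suc k) = 3" "y k = 0" "(\<Sum>i<k. y i) = 0"
    | "y (Suc k) = 2" "y k = 1" "(\<Sum>i<k. y i) = 0"
    | "y (Suc k) = 1" "y k = 1" "(\<Sum>i<k. y i) = 1" "k > 0" "y (k - 1) = 1"
  proof (cases "y k = 0")
    case True
    then have S: "(\<Sum>i<k. y i) = 0" using b by (cases "(\<Sum>i<k. y i) = 0") simp_all
    have "y (Suc k) = 3" using s True S by linarith
    then show ?thesis using True S by (rule that(1))
  next
    case False
    then have k1: "y k = 1" using a s by linarith
    show ?thesis
    proof (cases "(\<Sum>i<k. y i) = 0")
      case True
      moreover from this have "y (Suc k) = 2" using s k1 by linarith
      ultimately show ?thesis using k1 that(2) by blast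
    next
      case False
      then have S: "(\<Sum>i<k. y i) = 1" "y (Suc k) = 1" using k1 s a by linarith+
      then have "k > 0" "y (k - 1) = 1" using c k1 by simp_all
      then show ?thesis using k1 S that(3) by blast
    qed
  qed
  then show ?thesis
  proof cases
    case 1
    have "n - 1 = Suc k" "\<forall>i<Suc k. y i = 0" using 1(2) zero[OF 1(3)] by (simp_all add: n less_Suc_eq)
    moreover have "(\<Sum>i<n. (y i)\<^sup>2) = 9" unfolding sq 1(1,2) using zero[OF 1(3)] by simp
    ultimately show ?thesis using 1(1) by simp
  next
    case 2
    have "n - 1 = Suc k" "n - 2 = k" by (simp_all add: n)
    moreover have "(\<Sum>i<n. (y i)\<^sup>2) = 5" unfolding sq 2(1,2) using zero[OF 2(3)] by simp
    ultimately show ?thesis using 2(1,2) zero[OF 2(3)] by simp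
  next
    case 3
    then obtain l where l: "k = Suc l" by (cases k) auto
    have yl: "y l = 1" using 3(5) l by simp
    have S: "(\<Sum>i<l. y i) = 0" using 3(3) yl l by simp
    have "n - 1 = Suc k" "n - 2 = k" "n - 3 = l" "n \<ge> 3" by (simp_all add: n l)
    moreover have "(\<Sum>i<k. (y i)\<^sup>2) = 1" unfolding l using zero[OF S] yl by simp
    then have "(\<Sum>i<n. (y i)\<^sup>2) = 3" unfolding sq 3(1,2) by simp
    ultimately show ?thesis using 3(1,2) yl zero[OF S] by simp
  qed
qed

theorem theorem3p4:
  fixes f :: cpoly and d r m :: nat
    and \<rho> :: "nat \<Rightarrow> vec3" and \<sigma> :: "nat \<Rightarrow> nat \<Rightarrow> cpoly" and \<epsilon> :: "nat \<Rightarrow> nat"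
  assumes "d \<ge> 3" and "homogeneous d f" and "reduced f"
    and "\<not> concurrent_lines d f"
    and "min_gen_D0 f r m \<rho>"
    and "m > 3"
    and "(2 * int r - int d + 3) - int m = 3"
    and "gen_relations m \<rho> (m - 2) \<sigma> (\<lambda>i. \<epsilon> (Suc i))"
    and "\<forall>i j. 1 \<le> i \<longrightarrow> i \<le> j \<longrightarrow> j \<le> m - 2 \<longrightarrow> \<epsilon> i \<le> \<epsilon> j"
  shows "(\<epsilon> (m - 2) = 4 \<and> (\<forall>j. 1 \<le> j \<and> j \<le> m - 3 \<longrightarrow> \<epsilon> j = 1) \<and>
           int (tjurina f) = int d * (int d - 1) div 2 - 6 + int r * (int d - int r - 2))
       \<or> (\<epsilon> (m - 2) = 3 \<and> \<epsilon> (m - 3) = 2 \<and> (\<forall>j. 1 \<le> j \<and> j \<le> m - 4 \<longrightarrow> \<epsilon> j = 1) \<and>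
           int (tjurina f) = int d * (int d - 1) div 2 - 4 + int r * (int d - int r - 2))
       \<or> (\<epsilon> (m - 2) = 2 \<and> \<epsilon> (m - 3) = 2 \<and> \<epsilon> (m - 4) = 2 \<and>
           (\<forall>j. 1 \<le> j \<and> j \<le> m - 5 \<longrightarrow> \<epsilon> j = 1) \<and>
           int (tjurina f) = int d * (int d - 1) div 2 - 3 + int r * (int d - int r - 2))"
proof -
  define n where "n = m - 2"
  \<comment> \<open>Shifts the indices of \<open>\<epsilon>\<close>, which start at 1, to start at
    0.\<close>
  define e where "e i = \<epsilon> (Suc i)" for i
  have m: "m = n + 2" and "n \<ge> 2" using \<open>m > 3\<close> by (simp_all add: n_def)
  have r: "2 * int r = int d + int n + 2" using assms(7) m by simp
  have "d \<ge> 1" "r \<ge> 1" using r \<open>d \<ge> 3\<close> by simp_all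
  have gen: "generates (D0 f) m \<rho>" and vhom: "\<And>j. j < m \<Longrightarrow> vhomogeneous r (\<rho> j)"
    and min: "\<And>n' \<sigma>' k. n' < m \<Longrightarrow> \<forall>j<n'. vhomogeneous (k j) (\<sigma>' j) \<Longrightarrow> \<not> generates (D0 f) n' \<sigma>'"
    using assms(5) unfolding min_gen_D0_def by blast+
  have "gen_relations m \<rho> n \<sigma> e" using assms(8) by (simp add: n_def e_def[abs_def])
  with assms(2) gen vhom interpret resolution f d r m n \<rho> \<sigma> e by unfold_locales
  note main = degrees_and_tjurina[OF assms(3) \<open>d \<ge> 1\<close> \<open>r \<ge> 1\<close> m]
  have pos: "e i \<ge> 1" if i: "i < n" for i
  proof (rule ccontr)
    assume "\<not> e i \<ge> 1"
    then have "e i = 0" by simp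
    obtain j where "j < m" "\<sigma> i j \<noteq> 0" using main(1)[OF i] by blast
    from constant_relation_drops_generator[OF i \<open>e i = 0\<close> this]
    obtain b where b: "\<And>j. j < m - 1 \<Longrightarrow> b j < m" "generates (D0 f) (m - 1) (\<rho> \<circ> b)" by blast
    have "\<not> generates (D0 f) (m - 1) (\<rho> \<circ> b)"
      by (rule min[where k = "\<lambda>_. r"]) (use vhom b(1) m in auto)
    then show False using b(2) by blast
  qed
  define y where "y i = e i - 1" for i
  have e: "e i = Suc (y i)" if "i < n" for i using pos[OF that] by (simp add: y_def)
  have mono: "y i \<le> y j" if "i \<le> j" "j < n" for i j
  proof -
    have "e i \<le> e j" unfolding e_def using assms(9) that by (simp add: n_def)
    then show ?thesis by (simp add: y_def)
  qed
  have "(\<Sum>i<n. int (e i)) = (\<Sum>i<n. 1 + int (y i))" using e by (intro sum.cong) auto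
  \<comment> \<open>The degrees \<open>e i\<close> add up to \<open>2 r - (d - 1) = n + 3\<close>;
    lowering each of the \<open>n\<close> summands by 1 leaves 3.\<close>
  then have "int (\<Sum>i<n. y i) = 3" using main(2) r by (simp add: sum.distrib)
  then have sum: "(\<Sum>i<n. y i) = 3" by linarith
  have "(\<Sum>i<n. (int (e i))\<^sup>2) = (\<Sum>i<n. 1 + 2 * int (y i) + int ((y i)\<^sup>2))"
    using e by (intro sum.cong) (auto simp: power2_eq_square algebra_simps)
  also have "\<dots> = int n + 2 * int (\<Sum>i<n. y i) + int (\<Sum>i<n. (y i)\<^sup>2)"
    by (simp add: sum.distrib sum_distrib_left)
  finally have S2: "(\<Sum>i<n. (int (e i))\<^sup>2) = int n + 6 + int (\<Sum>i<n. (y i)\<^sup>2)" by (simp add: sum)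
  have n_int: "int n = 2 * int r - int d - 2" using r by simp
  have "2 * int (tjurina f) = int d * (int d - 1) + 2 * (int r * (int d - int r - 2)) - 3 - int (\<Sum>i<n. (y i)\<^sup>2)"
    unfolding main(3) S2 n_int by (simp add: power2_eq_square algebra_simps)
  moreover have "even (int d * (int d - 1))" by simp
  then have "2 * (int d * (int d - 1) div 2) = int d * (int d - 1)" by (rule dvd_mult_div_cancel)
  \<comment> \<open>The sums of squares 9, 5 and 3 give \<open>c\<close> = 6, 4 and 3, the constants
    of the three cases.\<close>
  ultimately have \<tau>: "int (tjurina f) = int d * (int d - 1) div 2 + int r * (int d - int r - 2) - c"
    if "int (\<Sum>i<n. (y i)\<^sup>2) = 2 * c - 3" for c
    using that by linarith
  have zero: "\<forall>j. 1 \<le> j \<and> j \<le> m - (k + 2) \<longrightarrow> \<epsilon> j = 1" if y0: "\<forall>i<n - k. y i = 0" for k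
  proof (intro allI impI)
    fix j assume j: "1 \<le> j \<and> j \<le> m - (k + 2)"
    then obtain i where i: "j = Suc i" by (cases j) auto
    then have "i < n - k" using j m by simp
    then show "\<epsilon> j = 1" using y0 e[of i] by (simp add: e_def i)
  qed
  \<comment> \<open>The offset 2 is \<open>m - n\<close>, and \<open>Suc k\<close> against
    \<open>k\<close> reflects counting \<open>y\<close> from 0 but \<open>\<epsilon>\<close> from
    1.\<close>
  have last: "\<epsilon> (m - (k + 2)) = Suc (y (n - Suc k))" if "k < n" for k
  proof -
    have "m - (k + 2) = Suc (n - Suc k)" using that m by simp
    then show ?thesis using e[of "n - Suc k"] that by (simp add: e_def)
  qed
  from sorted_partitions_of_3[of n y, OF mono sum \<open>n \<ge> 2\<close>]
  consider "y (n - 1) = 3" "\<forall>i<n - 1. y i = 0" "(\<Sum>i<n. (y i)\<^sup>2) = 9"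
    | "y (n - 1) = 2" "y (n - 2) = 1" "\<forall>i<n - 2. y i = 0" "(\<Sum>i<n. (y i)\<^sup>2) = 5"
    | "n \<ge> 3" "y (n - 1) = 1" "y (n - 2) = 1" "y (n - 3) = 1" "\<forall>i<n - 3. y i = 0" "(\<Sum>i<n. (y i)\<^sup>2) = 3"
    by blast
  then show ?thesis
  proof cases
    case 1
    then show ?thesis using last[of 0] zero[of 1] \<tau>[of 6] \<open>n \<ge> 2\<close>
      by (simp add: eval_nat_numeral)
  next
    case 2
    then show ?thesis using last[of 0] last[of 1] zero[of 2] \<tau>[of 4] \<open>n \<ge> 2\<close>
      by (simp add: eval_nat_numeral)
  next
    case 3
    then show ?thesis using last[of 0] last[of 1] last[of 2] zero[of 3] \<tau>[of 3] \<open>n \<ge> 2\<close>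
      by (simp add: eval_nat_numeral)
  qed
qed

end
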